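(* For each positive integer $n$ let $\mathcal{H}_n$ be the Hilbert scheme of $n$ points in $\mathbb{A}^n_{\mathbb{C}}$ and let $\mathcal{H}^{\mathrm{Gor}}_n\subseteq \mathcal{H}_n$ be its Gorenstein locus. The dimension of $\mathcal{H}^{\mathrm{Gor}}_n$, and hence that of $\mathcal{H}_n$, is lower-bounded by a cubic polynomial in $n$ for $n\to\infty$; that is, there exists a polynomial $p$ of degree $3$ with positive leading coefficient such that $\dim \mathcal{H}_n\geq \dim\mathcal{H}^{\mathrm{Gor}}_n\geq p(n)$ for all sufficiently large $n$.
   Context: The Hilbert scheme of $n$ points in $\mathbb{A}^n_{\mathbb{C}}$ parameterises the ideals $I\subseteq R=\mathbb{C}[x_1,\dots,x_n]$ with $\dim_{\mathbb{C}} R/I=n$; its Gorenstein locus is the open subscheme of those $I$ for which $R/I$ is a Gorenstein algebra. *)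

theory Defs
  imports
    "HOL-Library.Poly_Mapping"
    "HOL-Algebra.Embedded_Algebras"
    "HOL-Algebra.QuotRing"
    "HOL-Analysis.Analysis"
    "HOL-Computational_Algebra.Polynomial"
begin

section \<open>The polynomial ring\<close>

text \<open>
  A multivariate polynomial is a finitely supported map from monomials to coefficients, a monomial
  being a finitely supported exponent vector; the ring operations are those of
  \<^theory>\<open>HOL-Library.Poly_Mapping\<close> (multiplication is convolution). Since the number
  \<open>d\<close> of variables is a parameter, \<open>\<complex>[x\<^sub>0, \<dots>, x\<^sub>d\<^sub>-\<^sub>1]\<close> is carved out as a carrier set.
\<close>

type_synonym mpoly = "(nat \<Rightarrow>\<^sub>0 nat) \<Rightarrow>\<^sub>0 complex"

definition mpolys :: "nat \<Rightarrow> mpoly set" where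
  "mpolys d = {f. \<forall>m \<in> Poly_Mapping.keys f. Poly_Mapping.keys m \<subseteq> {..<d}}"

definition mpoly_ring :: "nat \<Rightarrow> mpoly ring" where
  "mpoly_ring d = \<lparr>carrier = mpolys d, monoid.mult = (*), one = 1, zero = 0, add = (+)\<rparr>"

definition const :: "complex \<Rightarrow> mpoly" where
  "const c = Poly_Mapping.single 0 c"

section \<open>The quotient algebras\<close>

abbreviation quot_alg :: "nat \<Rightarrow> mpoly set \<Rightarrow> mpoly set ring" where
  "quot_alg d I \<equiv> mpoly_ring d Quot I"

definition scalar :: "nat \<Rightarrow> mpoly set \<Rightarrow> complex \<Rightarrow> mpoly set" where
  "scalar d I c = I +>\<^bsub>mpoly_ring d\<^esub> const c"

definition hilb_points :: "nat \<Rightarrow> nat \<Rightarrow> mpoly set set" where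
  "hilb_points d r = {I. ideal I (mpoly_ring d) \<and>
     ring.dimension (quot_alg d I) r (range (scalar d I)) (carrier (quot_alg d I))}"

text \<open>
  The dualizing module \<open>\<omega>\<^sub>A = Hom\<^sub>\<complex>(A, \<complex>)\<close> of the finite algebra \<open>A = R/I\<close>, with the \<open>A\<close>-action
  \<open>(a \<cdot> \<phi>)(b) = \<phi>(a b)\<close>. Functionals are taken extensional, so that they are determined by their
  values on \<open>A\<close>.
\<close>

definition dual_space :: "nat \<Rightarrow> mpoly set \<Rightarrow> (mpoly set \<Rightarrow> complex) set" where
  "dual_space d I = {\<phi> \<in> carrier (quot_alg d I) \<rightarrow>\<^sub>E UNIV.
     (\<forall>a \<in> carrier (quot_alg d I). \<forall>b \<in> carrier (quot_alg d I).
        \<phi> (a \<oplus>\<^bsub>quot_alg d I\<^esub> b) = \<phi> a + \<phi> b) \<and>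
     (\<forall>c. \<forall>a \<in> carrier (quot_alg d I).
        \<phi> (scalar d I c \<otimes>\<^bsub>quot_alg d I\<^esub> a) = c * \<phi> a)}"

definition dual_add ::
    "nat \<Rightarrow> mpoly set \<Rightarrow> (mpoly set \<Rightarrow> complex) \<Rightarrow> (mpoly set \<Rightarrow> complex) \<Rightarrow> mpoly set \<Rightarrow> complex" where
  "dual_add d I \<phi> \<psi> = (\<lambda>b \<in> carrier (quot_alg d I). \<phi> b + \<psi> b)"

definition dual_act ::
    "nat \<Rightarrow> mpoly set \<Rightarrow> mpoly set \<Rightarrow> (mpoly set \<Rightarrow> complex) \<Rightarrow> mpoly set \<Rightarrow> complex" where
  "dual_act d I a \<phi> = (\<lambda>b \<in> carrier (quot_alg d I). \<phi> (a \<otimes>\<^bsub>quot_alg d I\<^esub> b))"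

text \<open>
  A finite \<open>\<complex>\<close>-algebra \<open>A\<close>, not necessarily local, is Gorenstein when \<open>A\<close> and \<open>\<omega>\<^sub>A\<close> are isomorphic
  as \<open>A\<close>-modules (for local \<open>A\<close> this is the definition of a zero-dimensional Gorenstein ring).
\<close>

definition gorenstein :: "nat \<Rightarrow> mpoly set \<Rightarrow> bool" where
  "gorenstein d I \<longleftrightarrow> (\<exists>\<Phi>. bij_betw \<Phi> (carrier (quot_alg d I)) (dual_space d I) \<and>
     (\<forall>a \<in> carrier (quot_alg d I). \<forall>b \<in> carrier (quot_alg d I).
        \<Phi> (a \<oplus>\<^bsub>quot_alg d I\<^esub> b) = dual_add d I (\<Phi> a) (\<Phi> b) \<and>
        \<Phi> (a \<otimes>\<^bsub>quot_alg d I\<^esub> b) = dual_act d I a (\<Phi> b)))"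

section \<open>The Zariski topology of the Hilbert scheme of points\<close>

text \<open>
  The Hilbert scheme of \<open>r\<close> points in \<open>\<A>\<^sup>d\<close> is glued from the affine open subschemes \<open>U\<^sub>B\<close>, for
  \<open>B\<close> a finite set of polynomials, whose points are those \<open>I\<close> such that \<open>B\<close> is a basis of \<open>R/I\<close>.
  The ring of regular functions on \<open>U\<^sub>B\<close> is generated by the functions sending \<open>I\<close> to the
  \<open>b\<close>-coordinate of \<open>f\<close> modulo \<open>I\<close>: \<open>U\<^sub>B\<close> is the closed subscheme of the affine space of tuples
  \<open>(M\<^sub>1, \<dots>, M\<^sub>d, v)\<close> (matrices of the multiplications by the variables, coordinates of \<open>1\<close>) cut out
  by \<open>M\<^sub>i M\<^sub>j = M\<^sub>j M\<^sub>i\<close> and \<open>b(M) v = e\<^sub>b\<close>; the entries of the \<open>M\<^sub>i\<close> and \<open>v\<close> are coordinates of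
  \<open>x\<^sub>i b\<close> and of \<open>1\<close>, and conversely the coordinates of \<open>f\<close> are the entries of \<open>f(M) v\<close>.

  The space below consists of the \<open>\<complex>\<close>-points with the Zariski topology. The scheme is of finite type
  over \<open>\<complex>\<close>, so restriction to the \<open>\<complex>\<close>-points is an isomorphism between the lattices of closed
  subsets, both for the scheme and for its open subschemes; in particular dimensions agree.
\<close>

definition is_coords :: "mpoly set \<Rightarrow> mpoly set \<Rightarrow> mpoly \<Rightarrow> (mpoly \<Rightarrow> complex) \<Rightarrow> bool" where
  "is_coords I B f c \<longleftrightarrow> c \<in> B \<rightarrow>\<^sub>E UNIV \<and> f - (\<Sum>b\<in>B. const (c b) * b) \<in> I"

definition coords :: "mpoly set \<Rightarrow> mpoly set \<Rightarrow> mpoly \<Rightarrow> mpoly \<Rightarrow> complex" where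
  "coords I B f = (THE c. is_coords I B f c)"

definition chart :: "nat \<Rightarrow> nat \<Rightarrow> mpoly set \<Rightarrow> mpoly set set" where
  "chart d r B = {I \<in> hilb_points d r. \<forall>f \<in> mpolys d. \<exists>!c. is_coords I B f c}"

inductive_set regular_functions :: "nat \<Rightarrow> mpoly set \<Rightarrow> (mpoly set \<Rightarrow> complex) set"
  for d :: nat and B :: "mpoly set" where
  const: "(\<lambda>I. a) \<in> regular_functions d B"
| coord: "f \<in> mpolys d \<Longrightarrow> b \<in> B \<Longrightarrow> (\<lambda>I. coords I B f b) \<in> regular_functions d B"
| add: "g \<in> regular_functions d B \<Longrightarrow> h \<in> regular_functions d B
    \<Longrightarrow> (\<lambda>I. g I + h I) \<in> regular_functions d B"
| mult: "g \<in> regular_functions d B \<Longrightarrow> h \<in> regular_functions d B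
    \<Longrightarrow> (\<lambda>I. g I * h I) \<in> regular_functions d B"

definition hilbert_scheme :: "nat \<Rightarrow> nat \<Rightarrow> mpoly set topology" where
  "hilbert_scheme d r = topology_generated_by
     {{I \<in> chart d r B. g I \<noteq> 0} | B g.
        finite B \<and> B \<subseteq> mpolys d \<and> g \<in> regular_functions d B}"

definition gorenstein_locus :: "nat \<Rightarrow> nat \<Rightarrow> mpoly set topology" where
  "gorenstein_locus d r =
     subtopology (hilbert_scheme d r) {I \<in> hilb_points d r. gorenstein d I}"

section \<open>Dimension of a topological space\<close>

definition irreducible_closedin :: "'a topology \<Rightarrow> 'a set \<Rightarrow> bool" where
  "irreducible_closedin X Z \<longleftrightarrow> closedin X Z \<and> Z \<noteq> {} \<and>
     (\<forall>A B. closedin X A \<longrightarrow> closedin X B \<longrightarrow> Z = A \<union> B \<longrightarrow> Z = A \<or> Z = B)"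

text \<open>
  The supremum of the lengths \<open>k\<close> of chains \<open>Z\<^sub>0 \<subset> \<dots> \<subset> Z\<^sub>k\<close>; it is \<open>-\<infinity>\<close> for the empty space and
  \<open>\<infinity>\<close> if the lengths are unbounded.
\<close>

definition krull_dim :: "'a topology \<Rightarrow> ereal" where
  "krull_dim X = Sup {ereal (real k) | k. \<exists>Z :: nat \<Rightarrow> 'a set.
     (\<forall>i\<le>k. irreducible_closedin X (Z i)) \<and> (\<forall>i<k. Z i \<subset> Z (Suc i))}"

end

(* Let l_t be the functional on C[x_0,...,x_{n-1}] that is 1 on x_{n-1} and on the quadrics
   x_i x_{n-1-i} with 0 < i < n-1, that has freely chosen values t on the cubic monomials in the
   variables x_k with 0 < 2k < n-1, and that vanishes on all other monomials. Whatever t is, the ideal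
   I_t of all f with l_t(f g) = 0 for all g has the basis 1, x_1, ..., x_{n-1} of its quotient, whose
   Gram matrix under l_t is a permutation matrix; so R/I_t is a Gorenstein algebra of length n. The number
   of parameters is cubic in n.

   Along every line in the parameter space the coordinates on the Hilbert scheme are rational functions
   of one variable, so open sets pull back to empty or cofinite subsets of the line; hence the image of
   every linear space of parameters is irreducible. As the values of t are themselves coordinates of
   monomials, a flag of coordinate subspaces gives a chain of irreducible closed sets whose length is
   the number of parameters. *)

theory Submission
  imports Defs "Jordan_Normal_Form.Determinant"
begin

section \<open>Chains of irreducible sets\<close>

text \<open>Phrased with open sets and for arbitrary subsets, so that images of parameter spaces
  qualify without being closed.\<close>

definition irreducible_in :: "'a topology \<Rightarrow> 'a set \<Rightarrow> bool" where
  "irreducible_in X S \<longleftrightarrow> S \<subseteq> topspace X \<and> S \<noteq> {} \<and>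
     (\<forall>U V. openin X U \<longrightarrow> openin X V \<longrightarrow> U \<inter> S \<noteq> {} \<longrightarrow> V \<inter> S \<noteq> {} \<longrightarrow> U \<inter> V \<inter> S \<noteq> {})"

text \<open>If neither \<open>A\<close> nor \<open>B\<close> contained \<open>S\<close>, their
  complements would be open sets meeting \<open>S\<close> and would share a point of
  \<open>S\<close>, which lies outside \<open>A \<union> B\<close>. So one of them contains
  \<open>S\<close> and, being closed, its closure.\<close>

lemma irreducible_closedin_closure_of:
  assumes "irreducible_in X S"
  shows "irreducible_closedin X (Abstract_Topology.closure_of X S)"
  unfolding irreducible_closedin_def
proof (intro conjI allI impI)
  have sub: "S \<subseteq> Abstract_Topology.closure_of X S"
    using assms closure_of_subset unfolding irreducible_in_def by blast
  show "Abstract_Topology.closure_of X S \<noteq> {}"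
    using sub assms unfolding irreducible_in_def by blast
  fix A B assume A: "closedin X A" and B: "closedin X B" and eq: "Abstract_Topology.closure_of X S = A \<union> B"
  show "Abstract_Topology.closure_of X S = A \<or> Abstract_Topology.closure_of X S = B"
  proof (rule ccontr)
    assume "\<not> ?thesis"
    then have "\<not> S \<subseteq> A" "\<not> S \<subseteq> B"
      using closure_of_minimal[of S A X] closure_of_minimal[of S B X] A B eq by blast+
    then have "(topspace X - A) \<inter> S \<noteq> {}" "(topspace X - B) \<inter> S \<noteq> {}"
      using assms unfolding irreducible_in_def by blast+
    then have "(topspace X - A) \<inter> (topspace X - B) \<inter> S \<noteq> {}"
      using assms A B unfolding irreducible_in_def by (meson openin_diff openin_topspace)
    then show False
      using sub eq by blast
  qed
qed simp

text \<open>Open sets \<open>U\<close> and \<open>V\<close> that meet \<open>Z\<close> but have no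
  common point in it would split \<open>Z\<close> into the proper relatively closed subsets
  \<open>Z - U\<close> and \<open>Z - V\<close>. In the larger space \<open>Z\<close> may fail to be
  closed, but it stays irreducible.\<close>

lemma irreducible_in_of_closedin_subtopology:
  assumes "irreducible_closedin (subtopology X Y) Z"
  shows "irreducible_in X Z"
  unfolding irreducible_in_def
proof (intro conjI allI impI)
  have Z: "closedin (subtopology X Y) Z" "Z \<noteq> {}"
    using assms by (auto simp: irreducible_closedin_def)
  then have ZX: "Z \<subseteq> topspace X" and ZY: "Z \<subseteq> Y"
    using closedin_subset by fastforce+
  show "Z \<subseteq> topspace X" "Z \<noteq> {}"
    using Z ZX by auto
  fix U V assume U: "openin X U" and V: "openin X V" and ne: "U \<inter> Z \<noteq> {}" "V \<inter> Z \<noteq> {}"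
  have cl: "closedin (subtopology X Y) (Z - W)" if "openin X W" for W
  proof -
    have "openin (subtopology X Y) (W \<inter> Y)"
      using that by (auto simp: openin_subtopology)
    then have "closedin (subtopology X Y) (Z - W \<inter> Y)"
      using Z by blast
    moreover have "Z - W \<inter> Y = Z - W"
      using ZY by blast
    ultimately show ?thesis by simp
  qed
  show "U \<inter> V \<inter> Z \<noteq> {}"
  proof
    assume "U \<inter> V \<inter> Z = {}"
    then have "Z = (Z - U) \<union> (Z - V)"
      by blast
    then have "Z = Z - U \<or> Z = Z - V"
      using assms cl[OF U] cl[OF V] unfolding irreducible_closedin_def by blast
    then show False
      using ne by blast
  qed
qed

text \<open>The chain of closed sets consists of the closures. An open set disjoint from
  \<open>S i\<close> is disjoint from its closure too, so the separating open sets keep the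
  inclusions strict.\<close>

lemma krull_dim_ge_chain:
  assumes irr: "\<And>i. i \<le> k \<Longrightarrow> irreducible_in X (S i)"
    and mono: "\<And>i. i < k \<Longrightarrow> S i \<subseteq> S (Suc i)"
    and sep: "\<And>i. i < k \<Longrightarrow> \<exists>U. openin X U \<and> U \<inter> S i = {} \<and> U \<inter> S (Suc i) \<noteq> {}"
  shows "ereal (real k) \<le> krull_dim X"
proof -
  have "Abstract_Topology.closure_of X (S i) \<subset> Abstract_Topology.closure_of X (S (Suc i))" if i: "i < k" for i
  proof -
    obtain U where U: "openin X U" "U \<inter> S i = {}" "U \<inter> S (Suc i) \<noteq> {}"
      using sep[OF i] by blast
    have "U \<inter> Abstract_Topology.closure_of X (S i) = {}"
      using U openin_Int_closure_of_eq_empty by blast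
    moreover have "S (Suc i) \<subseteq> Abstract_Topology.closure_of X (S (Suc i))"
      using irr[of "Suc i"] i closure_of_subset unfolding irreducible_in_def
      by (metis Suc_leI)
    ultimately show ?thesis
      using closure_of_mono[OF mono[OF i], of X] U(3) by blast
  qed
  moreover have "irreducible_closedin X (Abstract_Topology.closure_of X (S i))" if "i \<le> k" for i
    using irr that by (intro irreducible_closedin_closure_of)
  ultimately show ?thesis
    unfolding krull_dim_def
    by (intro Sup_upper CollectI exI[of _ k] conjI refl
        exI[of _ "\<lambda>i. Abstract_Topology.closure_of X (S i)"]) blast+
qed

text \<open>A chain in the subspace is a chain of irreducible sets of \<open>X\<close>. Writing
  \<open>Z i = T \<inter> Y\<close> with \<open>T\<close> closed in \<open>X\<close>, the complement
  of \<open>T\<close> separates \<open>Z i\<close> from \<open>Z (Suc i)\<close>.\<close>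

lemma krull_dim_subtopology_le: "krull_dim (subtopology X Y) \<le> krull_dim X"
  unfolding krull_dim_def[of "subtopology X Y"]
proof (rule Sup_least, clarify)
  fix k :: nat and Z :: "nat \<Rightarrow> 'a set"
  assume irr: "\<forall>i\<le>k. irreducible_closedin (subtopology X Y) (Z i)"
    and strict: "\<forall>i<k. Z i \<subset> Z (Suc i)"
  show "ereal (real k) \<le> krull_dim X"
  proof (rule krull_dim_ge_chain)
    show "irreducible_in X (Z i)" if "i \<le> k" for i
      using irr that irreducible_in_of_closedin_subtopology by blast
    show "Z i \<subseteq> Z (Suc i)" if "i < k" for i
      using strict that by blast
    show "\<exists>U. openin X U \<and> U \<inter> Z i = {} \<and> U \<inter> Z (Suc i) \<noteq> {}" if i: "i < k" for i
    proof -
      have c: "closedin (subtopology X Y) (Z i)" "closedin (subtopology X Y) (Z (Suc i))"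
        using irr i by (auto simp: irreducible_closedin_def)
      then obtain T where T: "closedin X T" "Z i = T \<inter> Y"
        by (auto simp: closedin_subtopology)
      have "Z (Suc i) \<subseteq> topspace X" "Z (Suc i) \<subseteq> Y"
        using closedin_subset[OF c(2)] by auto
      then show ?thesis
        using T strict i by (intro exI[of _ "topspace X - T"]) blast
    qed
  qed
qed

section \<open>The polynomial ring\<close>

lemma mpolys_zero [simp]: "0 \<in> mpolys d"
  and mpolys_one [simp]: "1 \<in> mpolys d"
  and mpolys_const [simp]: "const c \<in> mpolys d"
  by (auto simp: mpolys_def const_def split: if_splits)

lemma mpolys_add [simp]: "f \<in> mpolys d \<Longrightarrow> g \<in> mpolys d \<Longrightarrow> f + g \<in> mpolys d"
  using keys_add[of f g] by (auto simp: mpolys_def)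

lemma mpolys_uminus [simp]: "f \<in> mpolys d \<Longrightarrow> - f \<in> mpolys d"
  by (auto simp: mpolys_def in_keys_iff)

lemma mpolys_diff [simp]: "f \<in> mpolys d \<Longrightarrow> g \<in> mpolys d \<Longrightarrow> f - g \<in> mpolys d"
  using mpolys_add[of f d "- g"] by simp

lemma mpolys_mult [simp]:
  assumes "f \<in> mpolys d" "g \<in> mpolys d"
  shows "f * g \<in> mpolys d"
  unfolding mpolys_def
proof (intro CollectI ballI)
  fix m assume "m \<in> Poly_Mapping.keys (f * g)"
  then obtain a c where "m = a + c" "a \<in> Poly_Mapping.keys f" "c \<in> Poly_Mapping.keys g"
    using keys_mult[of f g] by blast
  then show "Poly_Mapping.keys m \<subseteq> {..<d}"
    using assms keys_add[of a c] unfolding mpolys_def by blast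
qed

lemma mpolys_sum [simp]: "(\<And>i. i \<in> A \<Longrightarrow> f i \<in> mpolys d) \<Longrightarrow> (\<Sum>i\<in>A. f i) \<in> mpolys d"
  by (induction A rule: infinite_finite_induct) auto

lemma const_zero [simp]: "const 0 = 0"
  by (simp add: const_def)

lemma mpoly_ring_simps [simp]:
  "carrier (mpoly_ring d) = mpolys d"
  "f \<otimes>\<^bsub>mpoly_ring d\<^esub> g = f * g"
  "f \<oplus>\<^bsub>mpoly_ring d\<^esub> g = f + g"
  "\<one>\<^bsub>mpoly_ring d\<^esub> = 1"
  "\<zero>\<^bsub>mpoly_ring d\<^esub> = 0"
  by (simp_all add: mpoly_ring_def)

lemma cring_mpoly_ring: "cring (mpoly_ring d)"
proof (rule cringI)
  show "abelian_group (mpoly_ring d)"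
  proof (rule abelian_groupI)
    show "\<exists>g \<in> carrier (mpoly_ring d). g \<oplus>\<^bsub>mpoly_ring d\<^esub> f = \<zero>\<^bsub>mpoly_ring d\<^esub>"
      if "f \<in> carrier (mpoly_ring d)" for f
      using that by (auto intro!: bexI[of _ "- f"])
  qed (auto simp: algebra_simps)
  show "comm_monoid (mpoly_ring d)"
    by (rule comm_monoidI) (auto simp: algebra_simps)
qed (auto simp: algebra_simps)

lemma a_r_coset_eq_iff:
  assumes "ideal I (mpoly_ring d)"
  shows "I +>\<^bsub>mpoly_ring d\<^esub> f = I +>\<^bsub>mpoly_ring d\<^esub> g \<longleftrightarrow> f - g \<in> I"
proof -
  interpret ideal I "mpoly_ring d" by fact
  have add: "a + c \<in> I" if "a \<in> I" "c \<in> I" for a c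
    using additive_subgroup.a_closed[OF is_additive_subgroup] that by simp
  have zero: "0 \<in> I"
    using additive_subgroup.zero_closed[OF is_additive_subgroup] by simp
  have neg: "- a \<in> I" if "a \<in> I" for a
    using I_l_closed[OF that, of "- 1"] by simp
  have mem: "h \<in> I +>\<^bsub>mpoly_ring d\<^esub> f \<longleftrightarrow> h - f \<in> I" for h f
    unfolding a_r_coset_def' by (auto simp: algebra_simps intro!: bexI[of _ "h - f"])
  show ?thesis
  proof
    assume "I +>\<^bsub>mpoly_ring d\<^esub> f = I +>\<^bsub>mpoly_ring d\<^esub> g"
    then show "f - g \<in> I"
      using mem[of f f] mem[of f g] zero by simp
  next
    assume fg: "f - g \<in> I"
    have "h - f \<in> I \<longleftrightarrow> h - g \<in> I" for h
      using add[OF _ fg, of "h - f"] add[OF _ neg[OF fg], of "h - g"] by auto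
    then show "I +>\<^bsub>mpoly_ring d\<^esub> f = I +>\<^bsub>mpoly_ring d\<^esub> g"
      using mem by blast
  qed
qed

lemma quot_alg_simps:
  assumes "ideal I (mpoly_ring d)"
  shows "carrier (quot_alg d I) = (\<lambda>f. I +>\<^bsub>mpoly_ring d\<^esub> f) ` mpolys d"
    and "f \<in> mpolys d \<Longrightarrow> g \<in> mpolys d \<Longrightarrow>
      (I +>\<^bsub>mpoly_ring d\<^esub> f) \<otimes>\<^bsub>quot_alg d I\<^esub> (I +>\<^bsub>mpoly_ring d\<^esub> g) = I +>\<^bsub>mpoly_ring d\<^esub> (f * g)"
    and "f \<in> mpolys d \<Longrightarrow> g \<in> mpolys d \<Longrightarrow>
      (I +>\<^bsub>mpoly_ring d\<^esub> f) \<oplus>\<^bsub>quot_alg d I\<^esub> (I +>\<^bsub>mpoly_ring d\<^esub> g) = I +>\<^bsub>mpoly_ring d\<^esub> (f + g)"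
    and "\<zero>\<^bsub>quot_alg d I\<^esub> = I +>\<^bsub>mpoly_ring d\<^esub> 0"
proof -
  interpret ideal I "mpoly_ring d" by fact
  show "carrier (quot_alg d I) = (\<lambda>f. I +>\<^bsub>mpoly_ring d\<^esub> f) ` mpolys d"
    by (auto simp: FactRing_def A_RCOSETS_def')
  show "(I +>\<^bsub>mpoly_ring d\<^esub> f) \<otimes>\<^bsub>quot_alg d I\<^esub> (I +>\<^bsub>mpoly_ring d\<^esub> g) = I +>\<^bsub>mpoly_ring d\<^esub> (f * g)"
    if "f \<in> mpolys d" "g \<in> mpolys d"
    using rcoset_mult_add[of f g] that by (simp add: FactRing_def)
  show "(I +>\<^bsub>mpoly_ring d\<^esub> f) \<oplus>\<^bsub>quot_alg d I\<^esub> (I +>\<^bsub>mpoly_ring d\<^esub> g) = I +>\<^bsub>mpoly_ring d\<^esub> (f + g)"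
    if "f \<in> mpolys d" "g \<in> mpolys d"
    using a_rcos_sum[of f g] that by (simp add: FactRing_def)
  show "\<zero>\<^bsub>quot_alg d I\<^esub> = I +>\<^bsub>mpoly_ring d\<^esub> 0"
  proof -
    have "0 \<in> I"
      using additive_subgroup.zero_closed[OF is_additive_subgroup] by simp
    then show ?thesis
      using a_rcos_zero[OF assms] by (simp add: FactRing_def)
  qed
qed

section \<open>Ideals apolar to a functional\<close>

text \<open>For linear \<open>L\<close> this is the radical of the form
  \<open>(f, g) \<mapsto> L (f * g)\<close>, equivalently the largest ideal inside the kernel of
  \<open>L\<close>: the ideal attached to \<open>L\<close> by Macaulay duality.\<close>

definition apolar :: "nat \<Rightarrow> (mpoly \<Rightarrow> complex) \<Rightarrow> mpoly set" where
  "apolar d L = {f \<in> mpolys d. \<forall>g \<in> mpolys d. L (f * g) = 0}"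

text \<open>An axiomatic form of dual bases for the pairing \<open>L (f * g)\<close>:
  \<open>L_dual\<close> makes the \<open>b i\<close> independent modulo its radical, and
  \<open>L_expand\<close> says that the pairing factors through \<open>n\<close> coordinates, so
  that they also span.\<close>

locale dual_functional =
  fixes d n :: nat and L :: "mpoly \<Rightarrow> complex" and b b' :: "nat \<Rightarrow> mpoly"
  assumes L_add: "L (f + g) = L f + L g"
    and L_scale: "L (const c * f) = c * L f"
    and b_in: "i < n \<Longrightarrow> b i \<in> mpolys d"
    and b'_in: "i < n \<Longrightarrow> b' i \<in> mpolys d"
    and L_dual: "i < n \<Longrightarrow> j < n \<Longrightarrow> L (b i * b' j) = (if i = j then 1 else 0)"
    and L_expand: "f \<in> mpolys d \<Longrightarrow> g \<in> mpolys d \<Longrightarrow>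
      L (f * g) = (\<Sum>i<n. L (f * b' i) * L (b i * g))"
begin

abbreviation I :: "mpoly set" where "I \<equiv> apolar d L"

abbreviation coset :: "mpoly \<Rightarrow> mpoly set" where "coset f \<equiv> I +>\<^bsub>mpoly_ring d\<^esub> f"

lemma L_zero [simp]: "L 0 = 0"
  using L_scale[of 0 0] by simp

lemma L_uminus: "L (- f) = - L f"
  using L_add[of f "- f"] by (simp add: eq_neg_iff_add_eq_0 add.commute)

lemma L_diff: "L (f - g) = L f - L g"
  using L_add[of f "- g"] L_uminus by simp

lemma L_sum: "L (\<Sum>i\<in>A. f i) = (\<Sum>i\<in>A. L (f i))"
  by (induction A rule: infinite_finite_induct) (auto simp: L_add)

lemma L_scale_mult: "L (const c * f * g) = c * L (f * g)"
  using L_scale[of c "f * g"] by (simp add: mult.assoc)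

section \<open>The quotient by the apolar ideal and its dimension\<close>

lemma ideal_apolar: "ideal I (mpoly_ring d)"
proof (rule idealI)
  show "ring (mpoly_ring d)"
    using cring_mpoly_ring cring.axioms(1) by blast
  show "subgroup I (add_monoid (mpoly_ring d))"
  proof (rule group.subgroupI)
    show "Group.group (add_monoid (mpoly_ring d))"
      by (intro abelian_group.a_group ring.is_abelian_group cring.axioms(1) cring_mpoly_ring)
    show "I \<noteq> {}"
      by (auto simp: apolar_def intro!: exI[of _ 0])
    show "inv\<^bsub>add_monoid (mpoly_ring d)\<^esub> f \<in> I" if f: "f \<in> I" for f
    proof -
      interpret cring "mpoly_ring d" by (rule cring_mpoly_ring)
      have "\<ominus>\<^bsub>mpoly_ring d\<^esub> f = - f"
        using f by (intro minus_equality) (auto simp: apolar_def)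
      then show ?thesis
        using f by (simp add: a_inv_def apolar_def L_uminus)
    qed
  qed (auto simp: apolar_def L_add distrib_right)
  fix f g assume f: "f \<in> I" and g: "g \<in> carrier (mpoly_ring d)"
  have "L (g * f * h) = 0" if "h \<in> mpolys d" for h
    using f g that unfolding apolar_def mult.commute[of g f] mult.assoc by simp
  then have "g * f \<in> I"
    using f g by (simp add: apolar_def)
  then show "g \<otimes>\<^bsub>mpoly_ring d\<^esub> f \<in> I" "f \<otimes>\<^bsub>mpoly_ring d\<^esub> g \<in> I"
    by (simp_all add: mult.commute[of f])
qed

text \<open>By \<open>L_expand\<close>, testing against the \<open>b' j\<close> suffices, so
  membership becomes finitely many linear conditions.\<close>

lemma mem_apolar_iff: "f \<in> I \<longleftrightarrow> f \<in> mpolys d \<and> (\<forall>j<n. L (f * b' j) = 0)"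
proof
  assume "f \<in> I"
  then show "f \<in> mpolys d \<and> (\<forall>j<n. L (f * b' j) = 0)"
    by (simp add: apolar_def b'_in)
next
  assume "f \<in> mpolys d \<and> (\<forall>j<n. L (f * b' j) = 0)"
  then show "f \<in> I"
    by (simp add: apolar_def L_expand)
qed

text \<open>For any candidate basis \<open>B\<close>, coordinates are the solutions of a linear
  system with matrix \<open>L (x * b' j)\<close>. Lying in the chart of \<open>B\<close> thereby
  becomes a question of invertibility.\<close>

lemma is_coords_iff:
  assumes "f \<in> mpolys d" "B \<subseteq> mpolys d"
  shows "is_coords I B f c \<longleftrightarrow>
    c \<in> B \<rightarrow>\<^sub>E UNIV \<and> (\<forall>j<n. L (f * b' j) = (\<Sum>x\<in>B. c x * L (x * b' j)))"
proof -
  have "f - (\<Sum>x\<in>B. const (c x) * x) \<in> mpolys d"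
    using assms by (intro mpolys_diff mpolys_sum mpolys_mult) auto
  moreover have "L ((f - (\<Sum>x\<in>B. const (c x) * x)) * g) = L (f * g) - (\<Sum>x\<in>B. c x * L (x * g))" for g
    by (simp add: left_diff_distrib sum_distrib_right L_diff L_sum L_scale_mult)
  ultimately show ?thesis
    by (simp add: is_coords_def mem_apolar_iff)
qed

lemma coset_eq_iff: "coset f = coset g \<longleftrightarrow> f - g \<in> I"
  by (rule a_r_coset_eq_iff[OF ideal_apolar])

lemma diff_basis_mem:
  assumes "f \<in> mpolys d"
  shows "f - (\<Sum>i<n. const (L (f * b' i)) * b i) \<in> I"
proof -
  have "f - (\<Sum>i<n. const (L (f * b' i)) * b i) \<in> mpolys d"
    using assms by (intro mpolys_diff mpolys_sum mpolys_mult) (auto simp: b_in)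
  then show ?thesis
    using assms
    by (simp add: mem_apolar_iff left_diff_distrib sum_distrib_right L_diff L_sum L_scale_mult L_dual
        if_distrib[of "\<lambda>x. _ * x"] sum.delta cong: if_cong)
qed

text \<open>The dimension is built up by line extensions, with \<open>E k\<close> the span of the
  first \<open>k\<close> basis cosets. Pairing with \<open>b' k\<close> kills \<open>E k\<close> but
  gives 1 on \<open>b k\<close>, so each extension is proper; \<open>diff_basis_mem\<close> shows
  that \<open>E n\<close> is everything.\<close>

lemma dimension_quot_alg:
  "ring.dimension (quot_alg d I) n (range (scalar d I)) (carrier (quot_alg d I))"
proof -
  interpret Q: ring "quot_alg d I"
    by (rule ideal.quotient_is_ring[OF ideal_apolar])
  note Q_simps = quot_alg_simps[OF ideal_apolar]
  define E where "E k = {coset (\<Sum>i<k. const (c i) * b i) | c. True}" for k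
  have ext: "Q.line_extension (range (scalar d I)) (coset (b k)) (E k) = E (Suc k)" if k: "k < n" for k
  proof -
    have comb: "scalar d I a \<otimes>\<^bsub>quot_alg d I\<^esub> coset (b k) \<oplus>\<^bsub>quot_alg d I\<^esub> coset (\<Sum>i<k. const (c i) * b i)
        = coset (const a * b k + (\<Sum>i<k. const (c i) * b i))" for a c
    proof -
      have "(\<Sum>i<k. const (c i) * b i) \<in> mpolys d" "b k \<in> mpolys d"
        using k by (auto intro!: mpolys_sum mpolys_mult b_in)
      then show ?thesis by (simp add: scalar_def Q_simps)
    qed
    show ?thesis
    proof (intro equalityI subsetI)
      fix u assume "u \<in> Q.line_extension (range (scalar d I)) (coset (b k)) (E k)"
      then obtain a c where "u = coset (const a * b k + (\<Sum>i<k. const (c i) * b i))"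
        unfolding Q.line_extension_mem_iff E_def using comb by auto
      then have "u = coset (\<Sum>i<Suc k. const ((c(k := a)) i) * b i)"
        by (simp add: add.commute)
      then show "u \<in> E (Suc k)"
        unfolding E_def by blast
    next
      fix u assume "u \<in> E (Suc k)"
      then obtain c where "u = coset (const (c k) * b k + (\<Sum>i<k. const (c i) * b i))"
        unfolding E_def by (auto simp: add.commute)
      then show "u \<in> Q.line_extension (range (scalar d I)) (coset (b k)) (E k)"
        unfolding Q.line_extension_mem_iff E_def comb[symmetric] by blast
    qed
  qed
  have notin: "coset (b k) \<notin> E k" if k: "k < n" for k
  proof
    assume "coset (b k) \<in> E k"
    then obtain c where "b k - (\<Sum>i<k. const (c i) * b i) \<in> I"
      unfolding E_def by (auto simp: coset_eq_iff)
    then have "L ((b k - (\<Sum>i<k. const (c i) * b i)) * b' k) = 0"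
      using k by (simp add: mem_apolar_iff)
    moreover have "(\<Sum>i<k. c i * L (b i * b' k)) = 0"
      using k by (intro sum.neutral) (auto simp: L_dual)
    ultimately show False
      using k by (simp add: left_diff_distrib sum_distrib_right L_diff L_sum L_scale_mult L_dual)
  qed
  have "Q.dimension k (range (scalar d I)) (E k)" if "k \<le> n" for k
    using that
  proof (induction k)
    case 0
    have "E 0 = {\<zero>\<^bsub>quot_alg d I\<^esub>}"
      by (auto simp: E_def Q_simps)
    then show ?case by simp
  next
    case (Suc k)
    then show ?case
      using Q.Suc_dim[of "coset (b k)" "E k" k "range (scalar d I)"] ext[of k] notin[of k]
      by (auto simp: Q_simps b_in)
  qed
  moreover have "E n = carrier (quot_alg d I)"
  proof (intro equalityI subsetI)
    fix u assume "u \<in> E n"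
    then show "u \<in> carrier (quot_alg d I)"
      unfolding E_def Q_simps by (auto intro!: mpolys_sum mpolys_mult b_in)
  next
    fix u assume "u \<in> carrier (quot_alg d I)"
    then obtain f where f: "f \<in> mpolys d" "u = coset f"
      unfolding Q_simps by blast
    then have "u = coset (\<Sum>i<n. const (L (f * b' i)) * b i)"
      using coset_eq_iff diff_basis_mem by blast
    then show "u \<in> E n"
      unfolding E_def by (intro CollectI exI[of _ "\<lambda>i. L (f * b' i)"]) simp
  qed
  ultimately show ?thesis
    by (metis order_refl)
qed

lemma apolar_in_hilb_points: "I \<in> hilb_points d n"
  using ideal_apolar dimension_quot_alg by (simp add: hilb_points_def)

section \<open>Coordinates in the chart of the dual basis\<close>

lemma inj_on_basis: "inj_on b {..<n}"
proof (rule inj_onI)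
  fix i j assume ij: "i \<in> {..<n}" "j \<in> {..<n}" and eq: "b i = b j"
  have "L (b j * b' i) = 1"
    using L_dual[of i i] ij(1) unfolding eq by simp
  then show "i = j"
    using L_dual[of j i] ij by (simp split: if_splits)
qed

text \<open>For the basis \<open>b\<close> the linear system of \<open>is_coords_iff\<close> has the
  identity matrix, by \<open>L_dual\<close>.\<close>

lemma is_coords_basis_iff:
  assumes "f \<in> mpolys d"
  shows "is_coords I (b ` {..<n}) f c \<longleftrightarrow>
    c \<in> b ` {..<n} \<rightarrow>\<^sub>E UNIV \<and> (\<forall>j<n. c (b j) = L (f * b' j))"
proof -
  have "(\<Sum>x\<in>b ` {..<n}. c x * L (x * b' j)) = c (b j)" if j: "j < n" for j
  proof -
    have "(\<Sum>x\<in>b ` {..<n}. c x * L (x * b' j)) = (\<Sum>i<n. c (b i) * L (b i * b' j))"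
      by (simp add: sum.reindex[OF inj_on_basis])
    also have "\<dots> = (\<Sum>i<n. if i = j then c (b i) else 0)"
      using j by (intro sum.cong) (simp_all add: L_dual)
    finally show ?thesis using j by simp
  qed
  moreover have "b ` {..<n} \<subseteq> mpolys d"
    using b_in by blast
  ultimately show ?thesis
    unfolding is_coords_iff[OF assms \<open>b ` {..<n} \<subseteq> mpolys d\<close>] by auto
qed

lemma ex1_coords_basis:
  assumes f: "f \<in> mpolys d"
  shows "\<exists>!c. is_coords I (b ` {..<n}) f c"
proof (rule ex1I[of _ "\<lambda>x \<in> b ` {..<n}. L (f * b' (the_inv_into {..<n} b x))"])
  show "is_coords I (b ` {..<n}) f (\<lambda>x \<in> b ` {..<n}. L (f * b' (the_inv_into {..<n} b x)))"
    using f by (auto simp: is_coords_basis_iff the_inv_into_f_f[OF inj_on_basis])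
  fix c assume c: "is_coords I (b ` {..<n}) f c"
  show "c = (\<lambda>x \<in> b ` {..<n}. L (f * b' (the_inv_into {..<n} b x)))"
  proof (rule PiE_ext)
    show "c \<in> b ` {..<n} \<rightarrow>\<^sub>E UNIV"
      using c f by (simp add: is_coords_basis_iff)
    show "c x = (\<lambda>x \<in> b ` {..<n}. L (f * b' (the_inv_into {..<n} b x))) x" if x: "x \<in> b ` {..<n}" for x
    proof -
      obtain j where "j < n" "x = b j"
        using x by auto
      then show ?thesis
        using c f by (simp add: is_coords_basis_iff the_inv_into_f_f[OF inj_on_basis])
    qed
  qed simp
qed

lemma apolar_in_chart: "I \<in> chart d n (b ` {..<n})"
  using apolar_in_hilb_points ex1_coords_basis by (simp add: chart_def)

lemma coords_basis:
  assumes "f \<in> mpolys d" "j < n"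
  shows "coords I (b ` {..<n}) f (b j) = L (f * b' j)"
  using theI'[OF ex1_coords_basis[OF assms(1)]] assms
  by (simp add: coords_def is_coords_basis_iff)

text \<open>Multiplication followed by \<open>L\<close> gives the isomorphism with the dual module.
  It is injective because the apolar ideal is exactly the radical of the pairing, and surjective
  because of the dual basis.\<close>

lemma gorenstein_apolar: "gorenstein d I"
proof -
  note Q_simps = quot_alg_simps[OF ideal_apolar]
  define A where "A = carrier (quot_alg d I)"
  \<comment> \<open>\<open>l\<close> is \<open>L\<close> descended to the quotient. The choice of
    representative is harmless, since pairing with 1 shows that \<open>L\<close> vanishes on the
    apolar ideal.\<close>
  define l where "l u = L (SOME f. f \<in> mpolys d \<and> u = coset f)" for u
  have A: "A = coset ` mpolys d"
    by (simp add: A_def Q_simps)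
  have l: "l (coset f) = L f" if f: "f \<in> mpolys d" for f
  proof -
    define g where "g = (SOME g. g \<in> mpolys d \<and> coset f = coset g)"
    have "g \<in> mpolys d \<and> coset f = coset g"
      unfolding g_def by (rule someI[of _ f]) (use f in simp)
    then have "f - g \<in> I"
      by (simp add: coset_eq_iff)
    then have "L ((f - g) * h) = 0" if "h \<in> mpolys d" for h
      using that by (simp add: apolar_def)
    from this[of 1] have "L f = L g"
      by (simp add: L_diff)
    then show ?thesis
      unfolding l_def g_def by simp
  qed
  define \<Phi> where "\<Phi> u = (\<lambda>v \<in> A. l (u \<otimes>\<^bsub>quot_alg d I\<^esub> v))" for u
  have Phi: "\<Phi> (coset f) (coset g) = L (f * g)" if "f \<in> mpolys d" "g \<in> mpolys d" for f g
    using that by (simp add: \<Phi>_def A Q_simps l)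
  have Phi_ext: "\<Phi> u \<in> A \<rightarrow>\<^sub>E UNIV" for u
    by (simp add: \<Phi>_def)
  have scal: "scalar d I c \<otimes>\<^bsub>quot_alg d I\<^esub> coset f = coset (const c * f)" if "f \<in> mpolys d" for c f
    using that by (simp add: scalar_def Q_simps)
  have Phi_dual: "\<Phi> (coset f) \<in> dual_space d I" if f: "f \<in> mpolys d" for f
    unfolding dual_space_def A_def[symmetric]
  proof (intro CollectI conjI ballI allI Phi_ext)
    fix u v assume "u \<in> A" "v \<in> A"
    then obtain g h where "u = coset g" "v = coset h" "g \<in> mpolys d" "h \<in> mpolys d"
      unfolding A by blast
    then show "\<Phi> (coset f) (u \<oplus>\<^bsub>quot_alg d I\<^esub> v) = \<Phi> (coset f) u + \<Phi> (coset f) v"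
      using f by (simp add: Q_simps Phi distrib_left L_add)
  next
    fix c u assume "u \<in> A"
    then obtain g where "u = coset g" "g \<in> mpolys d"
      unfolding A by blast
    then show "\<Phi> (coset f) (scalar d I c \<otimes>\<^bsub>quot_alg d I\<^esub> u) = c * \<Phi> (coset f) u"
      using f L_scale_mult[of c g f] by (simp add: scal Phi mult.commute[of f])
  qed
  have "bij_betw \<Phi> A (dual_space d I)"
  proof (rule bij_betwI')
    fix u v assume "u \<in> A" "v \<in> A"
    then obtain f g where fg: "u = coset f" "v = coset g" "f \<in> mpolys d" "g \<in> mpolys d"
      unfolding A by blast
    show "\<Phi> u = \<Phi> v \<longleftrightarrow> u = v"
    proof
      assume eq: "\<Phi> u = \<Phi> v"
      have "L ((f - g) * h) = 0" if "h \<in> mpolys d" for h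
        using Phi[of f h] Phi[of g h] that fg eq by (simp add: left_diff_distrib L_diff)
      then have "f - g \<in> I"
        using fg by (simp add: apolar_def)
      then show "u = v"
        using fg by (simp add: coset_eq_iff)
    qed simp
  next
    show "\<Phi> u \<in> dual_space d I" if "u \<in> A" for u
      using that Phi_dual unfolding A by blast
  next
    fix \<phi> assume phi: "\<phi> \<in> dual_space d I"
    have phi_add: "\<phi> (coset (f + g)) = \<phi> (coset f) + \<phi> (coset g)" if "f \<in> mpolys d" "g \<in> mpolys d" for f g
      using phi that unfolding dual_space_def A_def[symmetric] A by (auto simp: Q_simps)
    have phi_scale: "\<phi> (coset (const c * f)) = c * \<phi> (coset f)" if f: "f \<in> mpolys d" for c f
      using phi f unfolding dual_space_def A_def[symmetric] A by (auto simp: scal[OF f, symmetric])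
    have phi_sum: "\<phi> (coset (\<Sum>i<k. const (c i) * b i)) = (\<Sum>i<k. c i * \<phi> (coset (b i)))"
      if "k \<le> n" for c k
      using that
    proof (induction k)
      case 0
      then show ?case using phi_scale[of 0 0] by simp
    next
      case (Suc k)
      have "(\<Sum>i<k. const (c i) * b i) \<in> mpolys d" "b k \<in> mpolys d"
        using Suc.prems by (auto intro!: mpolys_sum mpolys_mult b_in)
      then show ?case
        using Suc by (simp add: phi_add phi_scale)
    qed
    \<comment> \<open>The representing element takes the values of \<open>\<phi>\<close> on the
      basis as coefficients of the dual basis.\<close>
    define f where "f = (\<Sum>i<n. const (\<phi> (coset (b i))) * b' i)"
    have f: "f \<in> mpolys d"
      unfolding f_def by (intro mpolys_sum mpolys_mult) (auto simp: b'_in)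
    have "\<phi> v = \<Phi> (coset f) v" for v
    proof (cases "v \<in> A")
      case True
      then obtain g where g: "v = coset g" "g \<in> mpolys d"
        unfolding A by blast
      have "v = coset (\<Sum>i<n. const (L (g * b' i)) * b i)"
        using g coset_eq_iff diff_basis_mem by blast
      then have "\<phi> v = (\<Sum>i<n. L (g * b' i) * \<phi> (coset (b i)))"
        by (simp add: phi_sum)
      also have "\<dots> = (\<Sum>i<n. \<phi> (coset (b i)) * L (b' i * g))"
        by (simp add: mult.commute)
      also have "\<dots> = L (f * g)"
        by (simp add: f_def sum_distrib_right L_sum L_scale_mult)
      finally show ?thesis
        using f g by (simp add: Phi)
    next
      case False
      then show ?thesis
        using phi Phi_ext[of "coset f"] unfolding dual_space_def A_def[symmetric]
        by (auto simp: PiE_iff extensional_def)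
    qed
    then show "\<exists>u\<in>A. \<phi> = \<Phi> u"
      using f unfolding A by blast
  qed
  moreover have "\<Phi> (u \<oplus>\<^bsub>quot_alg d I\<^esub> v) = dual_add d I (\<Phi> u) (\<Phi> v)
      \<and> \<Phi> (u \<otimes>\<^bsub>quot_alg d I\<^esub> v) = dual_act d I u (\<Phi> v)" if uv: "u \<in> A" "v \<in> A" for u v
  proof -
    obtain f g where fg: "u = coset f" "f \<in> mpolys d" "v = coset g" "g \<in> mpolys d"
      using uv unfolding A by blast
    have "\<Phi> (u \<oplus>\<^bsub>quot_alg d I\<^esub> v) w = dual_add d I (\<Phi> u) (\<Phi> v) w
      \<and> \<Phi> (u \<otimes>\<^bsub>quot_alg d I\<^esub> v) w = dual_act d I u (\<Phi> v) w" for w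
    proof (cases "w \<in> A")
      case True
      then obtain h where h: "w = coset h" "h \<in> mpolys d"
        unfolding A by blast
      then show ?thesis
        using True fg
        by (simp add: dual_add_def dual_act_def A_def[symmetric] Q_simps Phi distrib_right L_add
            mult.left_commute[of g f h] mult.assoc)
    next
      case False
      then show ?thesis
        by (simp add: dual_add_def dual_act_def A_def[symmetric] \<Phi>_def)
    qed
    then show ?thesis by blast
  qed
  ultimately show ?thesis
    unfolding gorenstein_def A_def by blast
qed

end

section \<open>Varying the functional along a line\<close>

text \<open>\<open>D\<close> is the determinant and \<open>A\<close> the adjugate, after an
  enumeration \<open>e\<close> of \<open>B\<close> makes the matrix square with numerical indices.
  Multiplying by the adjugate on either side will give uniqueness and existence of coordinates. A
  right inverse at \<open>s\<close> forces \<open>poly D s \<noteq> 0\<close>, because evaluation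
  commutes with determinants.\<close>

lemma adjugate_over_finite_set:
  fixes M :: "'b \<Rightarrow> nat \<Rightarrow> complex poly"
  assumes "finite B" "card B = n"
  obtains A :: "nat \<Rightarrow> 'b \<Rightarrow> complex poly" and D :: "complex poly"
  where "\<And>x y. x \<in> B \<Longrightarrow> y \<in> B \<Longrightarrow> (\<Sum>j<n. M x j * A j y) = (if x = y then D else 0)"
    and "\<And>i j. i < n \<Longrightarrow> j < n \<Longrightarrow> (\<Sum>x\<in>B. A i x * M x j) = (if i = j then D else 0)"
    and "\<And>s Q. (\<And>x y. x \<in> B \<Longrightarrow> y \<in> B \<Longrightarrow>
            (\<Sum>j<n. poly (M x j) s * Q j y) = (if x = y then 1 else 0)) \<Longrightarrow> poly D s \<noteq> 0"
proof -
  obtain e where e: "bij_betw e {..<n} B"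
    using ex_bij_betw_nat_finite[OF assms(1)] assms(2) by (auto simp: lessThan_atLeast0)
  define e' where "e' = the_inv_into {..<n} e"
  have e': "e' x < n" "e (e' x) = x" if "x \<in> B" for x
    using that bij_betw_apply[OF bij_betw_the_inv_into[OF e]] f_the_inv_into_f_bij_betw[OF e]
    unfolding e'_def by auto
  have e_in: "e i \<in> B" and e'e: "e' (e i) = i" if "i < n" for i
    using that bij_betw_apply[OF e] the_inv_into_f_f[OF bij_betw_imp_inj_on[OF e]]
    unfolding e'_def by auto
  define MM where "MM = mat n n (\<lambda>(i, j). M (e i) j)"
  define D where "D = Determinant.det MM"
  define AA where "AA = adj_mat MM"
  have MM: "MM \<in> carrier_mat n n"
    by (simp add: MM_def)
  note adj = adj_mat[OF MM, folded AA_def D_def]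
  have entry: "(\<Sum>j<n. X $$ (i, j) * Y $$ (j, k)) = (X * Y) $$ (i, k)"
    if "X \<in> carrier_mat n n" "Y \<in> carrier_mat n n" "i < n" "k < n"
    for X Y :: "'c :: comm_ring_1 mat" and i k
    using that by (auto simp: scalar_prod_def lessThan_atLeast0)
  show thesis
  proof (rule that[of "\<lambda>j x. AA $$ (j, e' x)" D])
    fix x y assume xy: "x \<in> B" "y \<in> B"
    have "(\<Sum>j<n. M x j * AA $$ (j, e' y)) = (\<Sum>j<n. MM $$ (e' x, j) * AA $$ (j, e' y))"
      using xy e' by (simp add: MM_def)
    also have "\<dots> = (if e' x = e' y then D else 0)"
      using xy e' by (subst entry[OF MM adj(1)]) (simp_all add: adj(2))
    also have "e' x = e' y \<longleftrightarrow> x = y"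
      using xy e'(2) by metis
    finally show "(\<Sum>j<n. M x j * AA $$ (j, e' y)) = (if x = y then D else 0)" .
  next
    fix i j assume ij: "i < n" "j < n"
    have "(\<Sum>x\<in>B. AA $$ (i, e' x) * M x j) = (\<Sum>k<n. AA $$ (i, e' (e k)) * M (e k) j)"
      by (rule sum.reindex_bij_betw[OF e, symmetric])
    also have "\<dots> = (\<Sum>k<n. AA $$ (i, k) * MM $$ (k, j))"
      using ij e'e by (simp add: MM_def)
    also have "\<dots> = (if i = j then D else 0)"
      using ij by (subst entry[OF adj(1) MM]) (simp_all add: adj(3))
    finally show "(\<Sum>x\<in>B. AA $$ (i, e' x) * M x j) = (if i = j then D else 0)" .
  next
    fix s Q assume Q: "\<And>x y. x \<in> B \<Longrightarrow> y \<in> B \<Longrightarrow>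
            (\<Sum>j<n. poly (M x j) s * Q j y) = (if x = y then 1 else 0)"
    define N where "N = map_mat (\<lambda>p. poly p s) MM"
    define R where "R = mat n n (\<lambda>(j, i). Q j (e i))"
    have N: "N \<in> carrier_mat n n" and R: "R \<in> carrier_mat n n"
      by (simp_all add: N_def R_def MM_def)
    interpret ev: comm_ring_hom "\<lambda>p. poly p s"
      by (unfold_locales) auto
    have "N * R = 1\<^sub>m n"
    proof (rule eq_matI)
      fix i k assume ik: "i < dim_row (1\<^sub>m n :: complex mat)" "k < dim_col (1\<^sub>m n :: complex mat)"
      have "(N * R) $$ (i, k) = (\<Sum>j<n. N $$ (i, j) * R $$ (j, k))"
        using ik by (intro entry[OF N R, symmetric]) auto
      also have "\<dots> = (\<Sum>j<n. poly (M (e i) j) s * Q j (e k))"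
        using ik by (simp add: N_def R_def MM_def)
      also have "\<dots> = (if i = k then 1 else 0)"
        using ik Q[of "e i" "e k"] e_in e'e by (metis index_one_mat(2,3))
      finally show "(N * R) $$ (i, k) = 1\<^sub>m n $$ (i, k)"
        using ik by simp
    qed (use N R in auto)
    then have "Determinant.det N * Determinant.det R = 1"
      using Determinant.det_mult[OF N R] by simp
    moreover have "Determinant.det N = poly D s"
      unfolding N_def D_def by (rule ev.hom_det)
    ultimately show "poly D s \<noteq> 0" by auto
  qed
qed

text \<open>A curve of functionals sharing one pair of dual bases, so that \<open>s\<close> enters
  only through the polynomial values of \<open>L s\<close>.\<close>

locale dual_family =
  fixes d n :: nat and L :: "complex \<Rightarrow> mpoly \<Rightarrow> complex" and b b' :: "nat \<Rightarrow> mpoly"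
  assumes dual: "dual_functional d n (L s) b b'"
    and polynomial: "\<exists>p. \<forall>s. L s f = poly p s"
begin

text \<open>Cramer's rule for the system of \<open>is_coords_iff\<close>: the chart condition at
  \<open>s0\<close> makes its determinant \<open>D\<close> nonzero there, and wherever
  \<open>D\<close> is nonzero the coordinates are quotients with denominator
  \<open>D\<close>.\<close>

lemma coords_rational:
  assumes B: "finite B" "B \<subseteq> mpolys d" and s0: "apolar d (L s0) \<in> chart d n B"
  obtains D :: "complex poly" and C :: "mpoly \<Rightarrow> mpoly \<Rightarrow> complex poly"
  where "poly D s0 \<noteq> 0"
    and "\<And>s. poly D s \<noteq> 0 \<Longrightarrow> apolar d (L s) \<in> chart d n B"
    and "\<And>s f x. poly D s \<noteq> 0 \<Longrightarrow> f \<in> mpolys d \<Longrightarrow> x \<in> B \<Longrightarrow>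
      coords (apolar d (L s)) B f x * poly D s = poly (C f x) s"
proof -
  obtain q where q: "\<And>s f. L s f = poly (q f) s"
    using polynomial by metis
  have coords_iff: "is_coords (apolar d (L s)) B f c \<longleftrightarrow>
      c \<in> B \<rightarrow>\<^sub>E UNIV \<and> (\<forall>j<n. L s (f * b' j) = (\<Sum>x\<in>B. c x * L s (x * b' j)))"
    if "f \<in> mpolys d" for s f c
    by (rule dual_functional.is_coords_iff[OF dual that B(2)])
  have ex1: "\<exists>!c. is_coords (apolar d (L s0)) B f c" if "f \<in> mpolys d" for f
    using s0 that by (simp add: chart_def)
  have b_in: "b i \<in> mpolys d" if "i < n" for i
    using dual_functional.b_in[OF dual that] .
  \<comment> \<open>The coordinates \<open>Q\<close> of the \<open>b i\<close> with respect to
    \<open>B\<close> give a one-sided inverse of the matrix at \<open>s0\<close>.\<close>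
  have "\<forall>i<n. \<exists>c. is_coords (apolar d (L s0)) B (b i) c"
    using ex1 b_in by blast
  then obtain Q where Q: "\<And>i. i < n \<Longrightarrow> is_coords (apolar d (L s0)) B (b i) (Q i)"
    by metis
  have QM: "(\<Sum>x\<in>B. Q i x * L s0 (x * b' j)) = (if i = j then 1 else 0)" if "i < n" "j < n" for i j
  proof -
    have "L s0 (b i * b' j) = (\<Sum>x\<in>B. Q i x * L s0 (x * b' j))"
      using Q[OF that(1)] that(2) unfolding coords_iff[OF b_in[OF that(1)]] by blast
    then show ?thesis
      using dual_functional.L_dual[OF dual that] by simp
  qed
  \<comment> \<open>The inverse on the other side comes from uniqueness: an element \<open>x\<close>
    of \<open>B\<close> has the unit vector as coordinates, and also the vector obtained by
    expanding \<open>x\<close> through the \<open>b j\<close>.\<close>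
  have MQ: "(\<Sum>j<n. L s0 (x * b' j) * Q j y) = (if x = y then 1 else 0)" if x: "x \<in> B" and y: "y \<in> B" for x y
  proof -
    have xin: "x \<in> mpolys d" using x B by blast
    have "is_coords (apolar d (L s0)) B x (\<lambda>y\<in>B. if x = y then 1 else 0)"
      using x by (simp add: coords_iff[OF xin] if_distrib[of "\<lambda>u. u * _"] B(1) cong: if_cong)
    moreover have "is_coords (apolar d (L s0)) B x (\<lambda>y\<in>B. \<Sum>j<n. L s0 (x * b' j) * Q j y)"
      unfolding coords_iff[OF xin]
    proof (intro conjI allI impI)
      fix k assume k: "k < n"
      have "(\<Sum>y\<in>B. (\<Sum>j<n. L s0 (x * b' j) * Q j y) * L s0 (y * b' k))
          = (\<Sum>j<n. L s0 (x * b' j) * (\<Sum>y\<in>B. Q j y * L s0 (y * b' k)))"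
        unfolding sum_distrib_right sum_distrib_left by (subst sum.swap) (simp add: mult.assoc)
      also have "\<dots> = L s0 (x * b' k)"
        using k by (simp add: QM if_distrib[of "\<lambda>u. _ * u"] cong: if_cong)
      finally show "L s0 (x * b' k) =
          (\<Sum>y\<in>B. (\<lambda>y\<in>B. \<Sum>j<n. L s0 (x * b' j) * Q j y) y * L s0 (y * b' k))"
        by simp
    qed simp
    ultimately have "(\<lambda>y\<in>B. \<Sum>j<n. L s0 (x * b' j) * Q j y) = (\<lambda>y\<in>B. if x = y then 1 else 0)"
      using ex1[OF xin] by blast
    from fun_cong[OF this, of y] show ?thesis
      using y by simp
  qed
  \<comment> \<open>Comparing the traces of the two products gives the equality of the dimensions.\<close>
  have "of_nat n = (\<Sum>i<n. \<Sum>x\<in>B. Q i x * L s0 (x * b' i))"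
    by (simp add: QM)
  also have "\<dots> = (\<Sum>x\<in>B. \<Sum>i<n. L s0 (x * b' i) * Q i x)"
    by (subst sum.swap) (simp add: mult.commute)
  also have "\<dots> = (of_nat (card B) :: complex)"
    by (simp add: MQ)
  finally have card: "card B = n"
    by (simp only: of_nat_eq_iff)
  obtain A D where
    MA: "\<And>x y. x \<in> B \<Longrightarrow> y \<in> B \<Longrightarrow> (\<Sum>j<n. q (x * b' j) * A j y) = (if x = y then D else 0)" and
    AM: "\<And>i j. i < n \<Longrightarrow> j < n \<Longrightarrow> (\<Sum>x\<in>B. A i x * q (x * b' j)) = (if i = j then D else 0)" and
    D: "\<And>s Q. (\<And>x y. x \<in> B \<Longrightarrow> y \<in> B \<Longrightarrow>
            (\<Sum>j<n. poly (q (x * b' j)) s * Q j y) = (if x = y then 1 else 0)) \<Longrightarrow> poly D s \<noteq> 0"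
    by (fact adjugate_over_finite_set[OF B(1) card, of "\<lambda>x j. q (x * b' j)"])
  \<comment> \<open>The Cramer numerator: the right-hand side of the system multiplied by the
    adjugate.\<close>
  define C where "C f x = (\<Sum>j<n. q (f * b' j) * A j x)" for f x
  have MA_s: "(\<Sum>j<n. L s (x * b' j) * poly (A j y) s) = (if x = y then poly D s else 0)"
    if "x \<in> B" "y \<in> B" for x y s
    using arg_cong[OF MA[OF that], of "\<lambda>p. poly p s"] by (simp add: q poly_sum)
  have AM_s: "(\<Sum>x\<in>B. poly (A i x) s * L s (x * b' j)) = (if i = j then poly D s else 0)"
    if "i < n" "j < n" for i j s
    using arg_cong[OF AM[OF that], of "\<lambda>p. poly p s"] by (simp add: q poly_sum)
  have unique: "c x * poly D s = poly (C f x) s"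
    if c: "is_coords (apolar d (L s)) B f c" and f: "f \<in> mpolys d" and x: "x \<in> B" for s f c x
  proof -
    have "poly (C f x) s = (\<Sum>j<n. (\<Sum>y\<in>B. c y * L s (y * b' j)) * poly (A j x) s)"
      using c f by (simp add: C_def poly_sum coords_iff q)
    also have "\<dots> = (\<Sum>y\<in>B. c y * (\<Sum>j<n. L s (y * b' j) * poly (A j x) s))"
      unfolding sum_distrib_right sum_distrib_left by (subst sum.swap) (simp add: mult.assoc)
    also have "\<dots> = c x * poly D s"
      using x B(1) by (simp add: MA_s if_distrib[of "\<lambda>u. _ * u"] cong: if_cong)
    finally show ?thesis ..
  qed
  have exists: "is_coords (apolar d (L s)) B f (\<lambda>x\<in>B. poly (C f x) s / poly D s)"
    if s: "poly D s \<noteq> 0" and f: "f \<in> mpolys d" for s f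
    unfolding coords_iff[OF f]
  proof (intro conjI allI impI)
    fix k assume k: "k < n"
    have "(\<Sum>x\<in>B. poly (C f x) s * L s (x * b' k))
        = (\<Sum>j<n. L s (f * b' j) * (\<Sum>x\<in>B. poly (A j x) s * L s (x * b' k)))"
      unfolding sum_distrib_right sum_distrib_left C_def poly_sum poly_mult q[symmetric]
      by (subst sum.swap) (simp add: mult.assoc)
    also have "\<dots> = L s (f * b' k) * poly D s"
      using k by (simp add: AM_s if_distrib[of "\<lambda>u. _ * u"] cong: if_cong)
    finally have "L s (f * b' k) = (\<Sum>x\<in>B. poly (C f x) s * L s (x * b' k)) / poly D s"
      using s by simp
    then show "L s (f * b' k) = (\<Sum>x\<in>B. (\<lambda>x\<in>B. poly (C f x) s / poly D s) x * L s (x * b' k))"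
      by (simp add: sum_divide_distrib)
  qed simp
  have ex1_s: "\<exists>!c. is_coords (apolar d (L s)) B f c" if s: "poly D s \<noteq> 0" and f: "f \<in> mpolys d" for s f
  proof (rule ex1I[of _ "\<lambda>x\<in>B. poly (C f x) s / poly D s"], rule exists[OF that])
    fix c assume c: "is_coords (apolar d (L s)) B f c"
    have "c x = poly (C f x) s / poly D s" if "x \<in> B" for x
      using unique[OF c f that] s by (simp add: eq_divide_eq)
    then show "c = (\<lambda>x\<in>B. poly (C f x) s / poly D s)"
      using c coords_iff[OF f] by (intro PiE_ext[of _ B "\<lambda>_. UNIV"]) auto
  qed
  show thesis
  proof (rule that[of D C])
    show "poly D s0 \<noteq> 0"
      by (rule D[of s0 Q]) (simp add: q[symmetric] MQ)
    show "apolar d (L s) \<in> chart d n B" if "poly D s \<noteq> 0" for s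
      using ex1_s[OF that] dual_functional.apolar_in_hilb_points[OF dual] by (simp add: chart_def)
    show "coords (apolar d (L s)) B f x * poly D s = poly (C f x) s"
      if "poly D s \<noteq> 0" "f \<in> mpolys d" "x \<in> B" for s f x
      using unique[OF theI'[OF ex1_s[OF that(1,2)]] that(2,3)] by (simp add: coords_def)
  qed
qed

text \<open>Where \<open>D\<close> does not vanish, \<open>g\<close> is a quotient of a polynomial
  \<open>G\<close> by a power of \<open>D\<close>. One point of the open set makes
  \<open>D * G\<close> a nonzero polynomial, and its finitely many roots contain the
  complement.\<close>

lemma basic_open_empty_or_cofinite:
  assumes B: "finite B" "B \<subseteq> mpolys d" and g: "g \<in> regular_functions d B"
  shows "{s. apolar d (L s) \<in> chart d n B \<and> g (apolar d (L s)) \<noteq> 0} = {} \<or>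
    finite (- {s. apolar d (L s) \<in> chart d n B \<and> g (apolar d (L s)) \<noteq> 0})" (is "?S = {} \<or> _")
proof (cases "?S = {}")
  case False
  then obtain s0 where s0: "apolar d (L s0) \<in> chart d n B" "g (apolar d (L s0)) \<noteq> 0"
    by blast
  obtain D C where D0: "poly D s0 \<noteq> 0"
    and ch: "\<And>s. poly D s \<noteq> 0 \<Longrightarrow> apolar d (L s) \<in> chart d n B"
    and C: "\<And>s f x. poly D s \<noteq> 0 \<Longrightarrow> f \<in> mpolys d \<Longrightarrow> x \<in> B \<Longrightarrow>
      coords (apolar d (L s)) B f x * poly D s = poly (C f x) s"
    using coords_rational[OF B s0(1)] by metis
  \<comment> \<open>Induction on the generation of regular functions; a sum or product has the
    common denominator with exponent \<open>k + l\<close>.\<close>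
  have "\<exists>G k. \<forall>s. poly D s \<noteq> 0 \<longrightarrow> g (apolar d (L s)) * poly D s ^ k = poly G s"
    using g
  proof induction
    case (const a)
    show ?case by (intro exI[of _ "[:a:]"] exI[of _ 0]) simp
  next
    case (coord f x)
    then show ?case using C by (intro exI[of _ "C f x"] exI[of _ 1]) simp
  next
    case (add g h)
    then obtain G k H l where
      G: "\<And>s. poly D s \<noteq> 0 \<Longrightarrow> poly G s = g (apolar d (L s)) * poly D s ^ k" and
      H: "\<And>s. poly D s \<noteq> 0 \<Longrightarrow> poly H s = h (apolar d (L s)) * poly D s ^ l" by metis
    then show ?case
      by (intro exI[of _ "G * D ^ l + H * D ^ k"] exI[of _ "k + l"])
        (simp add: G H poly_power power_add algebra_simps)
  next
    case (mult g h)
    then obtain G k H l where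
      G: "\<And>s. poly D s \<noteq> 0 \<Longrightarrow> poly G s = g (apolar d (L s)) * poly D s ^ k" and
      H: "\<And>s. poly D s \<noteq> 0 \<Longrightarrow> poly H s = h (apolar d (L s)) * poly D s ^ l" by metis
    then show ?case
      by (intro exI[of _ "G * H"] exI[of _ "k + l"])
        (simp add: G H power_add algebra_simps)
  qed
  then obtain G k where G: "\<And>s. poly D s \<noteq> 0 \<Longrightarrow> g (apolar d (L s)) * poly D s ^ k = poly G s"
    by blast
  have "poly (D * G) s0 \<noteq> 0"
    using G[OF D0] D0 s0(2) by auto
  then have "finite {s. poly (D * G) s = 0}"
    by (intro poly_roots_finite) auto
  moreover have "- ?S \<subseteq> {s. poly (D * G) s = 0}"
    using ch G by fastforce
  ultimately show ?thesis
    using finite_subset by blast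
qed simp

text \<open>Being empty or cofinite passes to finite intersections and arbitrary unions, so the case
  of basic open sets suffices.\<close>

lemma open_empty_or_cofinite:
  assumes "openin (hilbert_scheme d n) U"
  shows "{s. apolar d (L s) \<in> U} = {} \<or> finite (- {s. apolar d (L s) \<in> U})"
  using openin_topology_generated_by[OF assms[unfolded hilbert_scheme_def]]
proof induction
  case (Int U V)
  have "- {s. apolar d (L s) \<in> U \<inter> V} = - {s. apolar d (L s) \<in> U} \<union> - {s. apolar d (L s) \<in> V}"
    by blast
  then show ?case
    using Int.IH by auto
next
  case (UN K)
  show ?case
  proof (cases "{s. apolar d (L s) \<in> \<Union>K} = {}")
    case False
    then obtain U where U: "U \<in> K" "{s. apolar d (L s) \<in> U} \<noteq> {}"
      by blast
    then have "finite (- {s. apolar d (L s) \<in> U})"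
      using UN.IH by blast
    moreover have "- {s. apolar d (L s) \<in> \<Union>K} \<subseteq> - {s. apolar d (L s) \<in> U}"
      using U by blast
    ultimately show ?thesis
      using finite_subset by blast
  qed simp
next
  case (Basis U)
  then obtain B g where U: "U = {I \<in> chart d n B. g I \<noteq> 0}"
    and B: "finite B" "B \<subseteq> mpolys d" "g \<in> regular_functions d B" by blast
  show ?case
    using basic_open_empty_or_cofinite[OF B] unfolding U by simp
qed simp

end

section \<open>Functionals given by their values on monomials\<close>

definition linear_extension :: "((nat \<Rightarrow>\<^sub>0 nat) \<Rightarrow> complex) \<Rightarrow> mpoly \<Rightarrow> complex" where
  "linear_extension w f = (\<Sum>m\<in>Poly_Mapping.keys f. Poly_Mapping.lookup f m * w m)"

lemma linear_extension_superset:
  assumes "finite S" "Poly_Mapping.keys f \<subseteq> S"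
  shows "linear_extension w f = (\<Sum>m\<in>S. Poly_Mapping.lookup f m * w m)"
  unfolding linear_extension_def
  using assms by (intro sum.mono_neutral_left) (auto simp: in_keys_iff)

lemma linear_extension_add:
  "linear_extension w (f + g) = linear_extension w f + linear_extension w g"
proof -
  let ?S = "Poly_Mapping.keys f \<union> Poly_Mapping.keys g"
  have "linear_extension w h = (\<Sum>m\<in>?S. Poly_Mapping.lookup h m * w m)"
    if "Poly_Mapping.keys h \<subseteq> ?S" for h
    using that by (intro linear_extension_superset) auto
  then show ?thesis
    using keys_add[of f g] by (simp add: lookup_add distrib_right sum.distrib)
qed

lemma linear_extension_sum:
  "linear_extension w (\<Sum>i\<in>A. f i) = (\<Sum>i\<in>A. linear_extension w (f i))"
  by (induction A rule: infinite_finite_induct)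
    (auto simp: linear_extension_add, simp_all add: linear_extension_def)

lemma linear_extension_single: "linear_extension w (Poly_Mapping.single m c) = c * w m"
  by (cases "c = 0") (simp_all add: linear_extension_def)

lemma sum_single_lookup:
  "(\<Sum>m\<in>Poly_Mapping.keys f. Poly_Mapping.single m (Poly_Mapping.lookup f m)) = f"
  by (rule poly_mapping_eqI)
    (auto simp: lookup_sum lookup_single when_def in_keys_iff)

lemma linear_extension_mult:
  "linear_extension w (f * g) = (\<Sum>k\<in>Poly_Mapping.keys f. \<Sum>l\<in>Poly_Mapping.keys g.
     Poly_Mapping.lookup f k * Poly_Mapping.lookup g l * w (k + l))"
proof -
  have "f * g = (\<Sum>k\<in>Poly_Mapping.keys f. Poly_Mapping.single k (Poly_Mapping.lookup f k)) *
      (\<Sum>l\<in>Poly_Mapping.keys g. Poly_Mapping.single l (Poly_Mapping.lookup g l))"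
    by (simp only: sum_single_lookup)
  also have "\<dots> = (\<Sum>k\<in>Poly_Mapping.keys f. \<Sum>l\<in>Poly_Mapping.keys g.
      Poly_Mapping.single (k + l) (Poly_Mapping.lookup f k * Poly_Mapping.lookup g l))"
    by (simp add: sum_product mult_single)
  finally show ?thesis
    by (simp add: linear_extension_sum linear_extension_single)
qed

lemma linear_extension_mult_single:
  "linear_extension w (f * Poly_Mapping.single l 1)
     = (\<Sum>k\<in>Poly_Mapping.keys f. Poly_Mapping.lookup f k * w (k + l))"
  by (simp add: linear_extension_mult)

lemma linear_extension_scale: "linear_extension w (const c * f) = c * linear_extension w f"
proof (cases "c = 0")
  case False
  then show ?thesis
    by (simp add: linear_extension_mult const_def linear_extension_def[of w f] sum_distrib_left mult.assoc)
qed (simp add: linear_extension_def)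

text \<open>The support of \<open>f\<close> does not vary with \<open>s\<close>, so a finite
  combination of the \<open>q m\<close> works.\<close>

lemma linear_extension_poly:
  assumes "\<And>s m. w s m = poly (q m) s"
  shows "\<exists>p. \<forall>s. linear_extension (w s) f = poly p s"
  by (intro exI[of _ "\<Sum>m\<in>Poly_Mapping.keys f. Polynomial.smult (Poly_Mapping.lookup f m) (q m)"])
    (simp add: linear_extension_def poly_sum assms)

section \<open>The family of functionals\<close>

text \<open>
  Since \<open>unit_expo 0 = 0\<close>, the linear monomial \<open>x\<^sub>n\<^sub>-\<^sub>1\<close> belongs to \<open>quadrics n\<close>, and the first basis
  element \<open>basis_mono 0\<close> is \<open>1\<close>; the variable \<open>x\<^sub>0\<close> lies in every ideal of the family.
\<close>

definition unit_expo :: "nat \<Rightarrow> (nat \<Rightarrow>\<^sub>0 nat)" where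
  "unit_expo i = (if i = 0 then 0 else Poly_Mapping.single i 1)"

definition expo_degree :: "nat \<Rightarrow> (nat \<Rightarrow>\<^sub>0 nat) \<Rightarrow> nat" where
  "expo_degree n m = (\<Sum>k<n. Poly_Mapping.lookup m k)"

definition quadrics :: "nat \<Rightarrow> (nat \<Rightarrow>\<^sub>0 nat) set" where
  "quadrics n = {unit_expo i + unit_expo j | i j. i + j + 1 = n}"

text \<open>Only variables from the lower half are allowed: \<open>x_i\<close> and
  \<open>x_{n-1-i}\<close> can then never both occur in such monomials.\<close>

definition cubics :: "nat \<Rightarrow> (nat \<Rightarrow>\<^sub>0 nat) set" where
  "cubics n = {m. Poly_Mapping.keys m \<subseteq> {k. 0 < k \<and> 2 * k + 1 < n} \<and> expo_degree n m = 3}"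

text \<open>\<open>quadrics n\<close> and \<open>cubics n\<close> are disjoint by degree, so
  \<open>t\<close> never disturbs the normalised pairing in degrees up to 2.\<close>

definition weight :: "nat \<Rightarrow> ((nat \<Rightarrow>\<^sub>0 nat) \<Rightarrow> complex) \<Rightarrow> (nat \<Rightarrow>\<^sub>0 nat) \<Rightarrow> complex" where
  "weight n t m = (if m \<in> quadrics n then 1 else if m \<in> cubics n then t m else 0)"

definition basis_mono :: "nat \<Rightarrow> mpoly" where
  "basis_mono i = Poly_Mapping.single (unit_expo i) 1"

section \<open>Degrees of exponents and the Gram matrix of the family\<close>

lemma expo_degree_add: "expo_degree n (k + l) = expo_degree n k + expo_degree n l"
  by (simp add: expo_degree_def lookup_add sum.distrib)

lemma expo_degree_unit_expo: "i < n \<Longrightarrow> expo_degree n (unit_expo i) = (if i = 0 then 0 else 1)"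
  by (simp add: expo_degree_def unit_expo_def lookup_single when_def)

lemma expo_degree_quadrics: "m \<in> quadrics n \<Longrightarrow> expo_degree n m \<le> 2"
  by (auto simp: quadrics_def expo_degree_add expo_degree_unit_expo)

lemma lookup_zero_quadrics: "m \<in> quadrics n \<Longrightarrow> Poly_Mapping.lookup m 0 = 0"
  by (auto simp: quadrics_def lookup_add unit_expo_def lookup_single)

lemma lookup_zero_cubics: "m \<in> cubics n \<Longrightarrow> Poly_Mapping.lookup m 0 = 0"
  by (auto simp: cubics_def in_keys_iff)

text \<open>The weighted degree in which \<open>x\<^sub>i\<close> has degree \<open>i\<close> determines \<open>i + j\<close>.\<close>

lemma unit_expo_add_in_quadrics_iff:
  assumes "i < n" "j < n"
  shows "unit_expo i + unit_expo j \<in> quadrics n \<longleftrightarrow> i + j + 1 = n"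
proof
  define wd where "wd m = (\<Sum>k<n. k * Poly_Mapping.lookup m k)" for m :: "nat \<Rightarrow>\<^sub>0 nat"
  have wd_add: "wd (k + l) = wd k + wd l" for k l
    by (simp add: wd_def lookup_add distrib_left sum.distrib)
  have wd_unit: "wd (unit_expo i) = i" if "i < n" for i
    using that by (simp add: wd_def unit_expo_def lookup_single when_def if_distrib[of "\<lambda>x. _ * x"] cong: if_cong)
  assume "unit_expo i + unit_expo j \<in> quadrics n"
  then obtain k l where kl: "unit_expo i + unit_expo j = unit_expo k + unit_expo l" "k + l + 1 = n"
    unfolding quadrics_def by blast
  have "wd (unit_expo i + unit_expo j) = i + j" "wd (unit_expo k + unit_expo l) = k + l"
    using assms kl(2) by (simp_all add: wd_add wd_unit)
  then show "i + j + 1 = n"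
    using kl by simp
qed (auto simp: quadrics_def)

text \<open>The Gram matrix of the basis is antidiagonal and independent of \<open>t\<close>, since
  products of two basis elements have degree at most 2.\<close>

lemma weight_unit_expo_add:
  assumes "i < n" "j < n"
  shows "weight n t (unit_expo i + unit_expo j) = (if i + j + 1 = n then 1 else 0)"
proof -
  have "unit_expo i + unit_expo j \<notin> cubics n"
    using assms by (auto simp: cubics_def expo_degree_add expo_degree_unit_expo)
  then show ?thesis
    using assms by (simp add: weight_def unit_expo_add_in_quadrics_iff)
qed

text \<open>Splitting off a variable \<open>x_k\<close> leaves a nonconstant factor, since otherwise
  \<open>m\<close> would be \<open>unit_expo k\<close>.\<close>

lemma degree_ge_2_if_not_unit_expo:
  assumes m: "Poly_Mapping.keys m \<subseteq> {..<n}" "Poly_Mapping.lookup m 0 = 0" and ne: "\<And>i. i < n \<Longrightarrow> m \<noteq> unit_expo i"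
    and n: "0 < n"
  shows "expo_degree n m \<ge> 2"
proof -
  have "m \<noteq> 0"
    using ne[OF n] by (simp add: unit_expo_def)
  then obtain k where k: "Poly_Mapping.lookup m k \<noteq> 0"
    by (metis poly_mapping_eqI lookup_zero)
  then have "k \<in> Poly_Mapping.keys m"
    by (simp add: in_keys_iff)
  then have kn: "k < n" "k \<noteq> 0"
    using m k by (blast, metis)
  define m' where "m' = m - Poly_Mapping.single k 1"
  have m': "m = unit_expo k + m'"
    using k kn by (intro poly_mapping_eqI)
      (auto simp: m'_def unit_expo_def lookup_add lookup_minus lookup_single when_def)
  have "m' \<noteq> 0"
    using ne[OF kn(1)] m' by auto
  then obtain l where l: "Poly_Mapping.lookup m' l \<noteq> 0"
    by (metis poly_mapping_eqI lookup_zero)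
  then have "l \<in> Poly_Mapping.keys m"
    unfolding m' by (simp add: in_keys_iff lookup_add)
  then have "l < n"
    using m(1) by blast
  then have "expo_degree n m' \<ge> Poly_Mapping.lookup m' l"
    unfolding expo_degree_def by (intro member_le_sum) auto
  then show ?thesis
    using l m' kn by (simp add: expo_degree_add expo_degree_unit_expo)
qed

lemma weight_zero_variable: "Poly_Mapping.lookup m 0 \<noteq> 0 \<Longrightarrow> weight n t m = 0"
  using lookup_zero_quadrics lookup_zero_cubics by (auto simp: weight_def)

lemma weight_eq_0_if_degree_gt_3: "expo_degree n m > 3 \<Longrightarrow> weight n t m = 0"
  using expo_degree_quadrics[of m n] by (auto simp: weight_def cubics_def)

text \<open>For \<open>j \<noteq> 0\<close> the product has degree at least 3, so nonzero weight
  puts it in \<open>cubics n\<close>, where all indices are low. For \<open>j = 0\<close> the bound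
  is just \<open>n \<ge> 2\<close>.\<close>

lemma low_index_if_weight_nonzero:
  assumes nz: "weight n t (m + unit_expo j) \<noteq> 0" and deg: "expo_degree n m \<ge> 2" and j: "j < n" "n \<ge> 2"
  shows "2 * j + 1 < n"
proof (cases "j = 0")
  case False
  have "expo_degree n (m + unit_expo j) \<ge> 3"
    using deg j False by (simp add: expo_degree_add expo_degree_unit_expo)
  then have "m + unit_expo j \<in> cubics n"
    using nz expo_degree_quadrics[of "m + unit_expo j" n] by (auto simp: weight_def split: if_splits)
  moreover have "j \<in> Poly_Mapping.keys (m + unit_expo j)"
    using False by (simp add: in_keys_iff lookup_add unit_expo_def)
  ultimately show ?thesis
    by (auto simp: cubics_def)
qed (use j in simp)

text \<open>
  When neither exponent is at most linear, the right-hand side vanishes because \<open>i\<close> and \<open>n - 1 - i\<close>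
  cannot both lie in the lower half.
\<close>

lemma weight_expand:
  assumes n: "n \<ge> 2" and k: "Poly_Mapping.keys k \<subseteq> {..<n}" and l: "Poly_Mapping.keys l \<subseteq> {..<n}"
  shows "weight n t (k + l) =
    (\<Sum>i<n. weight n t (k + unit_expo (n - 1 - i)) * weight n t (unit_expo i + l))"
proof -
  have deg: "expo_degree n m \<ge> 2"
    if "Poly_Mapping.keys m \<subseteq> {..<n}" "Poly_Mapping.lookup m 0 = 0" "\<not> (\<exists>i<n. m = unit_expo i)" for m
    using that n by (intro degree_ge_2_if_not_unit_expo) auto
  consider (zero) "Poly_Mapping.lookup k 0 \<noteq> 0 \<or> Poly_Mapping.lookup l 0 \<noteq> 0"
    | (left) i where "i < n" "k = unit_expo i"
    | (right) i where "i < n" "l = unit_expo i"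
    | (high) "expo_degree n k \<ge> 2" "expo_degree n l \<ge> 2"
    using deg[OF k] deg[OF l] by blast
  then show ?thesis
  proof cases
    case zero
    then have "weight n t (k + unit_expo (n - 1 - i)) * weight n t (unit_expo i + l) = 0" for i
      by (auto simp: weight_zero_variable lookup_add)
    then show ?thesis
      using zero by (auto simp: weight_zero_variable lookup_add)
  next
    \<comment> \<open>Pairing a basis element with the basis leaves one summand, by the antidiagonal
      Gram matrix; the case \<open>right\<close> is symmetric.\<close>
    case left
    have "(\<Sum>j<n. weight n t (k + unit_expo (n - 1 - j)) * weight n t (unit_expo j + l))
        = (\<Sum>j<n. if j = i then weight n t (unit_expo j + l) else 0)"
    proof (rule sum.cong)
      fix j assume "j \<in> {..<n}"
      then have "i + (n - 1 - j) + 1 = n \<longleftrightarrow> j = i" "n - 1 - j < n"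
        using left by auto
      then show "weight n t (k + unit_expo (n - 1 - j)) * weight n t (unit_expo j + l) =
          (if j = i then weight n t (unit_expo j + l) else 0)"
        using left by (simp add: weight_unit_expo_add)
    qed simp
    then show ?thesis
      using left by simp
  next
    case right
    have "(\<Sum>j<n. weight n t (k + unit_expo (n - 1 - j)) * weight n t (unit_expo j + l))
        = (\<Sum>j<n. if j = n - 1 - i then weight n t (k + unit_expo (n - 1 - j)) else 0)"
    proof (rule sum.cong)
      fix j assume "j \<in> {..<n}"
      then have "j + i + 1 = n \<longleftrightarrow> j = n - 1 - i" "j < n"
        using right by auto
      then show "weight n t (k + unit_expo (n - 1 - j)) * weight n t (unit_expo j + l) =
          (if j = n - 1 - i then weight n t (k + unit_expo (n - 1 - j)) else 0)"
        using right by (simp add: weight_unit_expo_add)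
    qed simp
    moreover have "n - 1 - (n - 1 - i) = i" "n - 1 - i < n"
      using right by auto
    ultimately show ?thesis
      using right by simp
  next
    case high
    have "weight n t (k + unit_expo (n - 1 - i)) * weight n t (unit_expo i + l) = 0" if i: "i < n" for i
    proof (rule ccontr)
      assume "\<not> ?thesis"
      then have "weight n t (k + unit_expo (n - 1 - i)) \<noteq> 0" "weight n t (l + unit_expo i) \<noteq> 0"
        by (auto simp: add.commute)
      then have "2 * (n - 1 - i) + 1 < n" "2 * i + 1 < n"
        using low_index_if_weight_nonzero[of n t k "n - 1 - i"] low_index_if_weight_nonzero[of n t l i]
          high i n by simp_all
      then show False by linarith
    qed
    then have "(\<Sum>i<n. weight n t (k + unit_expo (n - 1 - i)) * weight n t (unit_expo i + l)) = 0"
      by (intro sum.neutral) blast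
    moreover have "weight n t (k + l) = 0"
      using high by (intro weight_eq_0_if_degree_gt_3) (simp add: expo_degree_add)
    ultimately show ?thesis by simp
  qed
qed

section \<open>The family as an instance of dual functionals\<close>

lemma basis_mono_in_mpolys: "i < d \<Longrightarrow> basis_mono i \<in> mpolys d"
  by (simp add: mpolys_def basis_mono_def unit_expo_def)

text \<open>Reversing the indices turns the antidiagonal Gram matrix into the identity. The
  expansion axiom follows from \<open>weight_expand\<close> by bilinearity.\<close>

lemma dual_functional_weight:
  assumes n: "n \<ge> 2"
  shows "dual_functional n n (linear_extension (weight n t)) basis_mono (\<lambda>i. basis_mono (n - 1 - i))"
proof
  fix i j assume ij: "i < n" "j < n"
  then have "i + (n - 1 - j) + 1 = n \<longleftrightarrow> i = j" "n - 1 - j < n" by auto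
  then show "linear_extension (weight n t) (basis_mono i * basis_mono (n - 1 - j)) = (if i = j then 1 else 0)"
    using ij by (simp add: basis_mono_def mult_single linear_extension_single weight_unit_expo_add)
next
  fix f g assume fg: "f \<in> mpolys n" "g \<in> mpolys n"
  let ?w = "weight n t" and ?f = "Poly_Mapping.lookup f" and ?g = "Poly_Mapping.lookup g"
  let ?F = "Poly_Mapping.keys f" and ?G = "Poly_Mapping.keys g"
  have "linear_extension ?w (f * g) = (\<Sum>k\<in>?F. \<Sum>l\<in>?G. ?f k * ?g l * ?w (k + l))"
    by (rule linear_extension_mult)
  \<comment> \<open>Each summand is grouped into a factor in \<open>k\<close> and a factor in
    \<open>l\<close>, so the double sum factors once the sum over \<open>i\<close> is
    outermost.\<close>
  also have "\<dots> = (\<Sum>k\<in>?F. \<Sum>l\<in>?G. \<Sum>i<n.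
      (?f k * ?w (k + unit_expo (n - 1 - i))) * (?g l * ?w (unit_expo i + l)))"
  proof (intro sum.cong refl)
    fix k l assume "k \<in> ?F" "l \<in> ?G"
    then have "Poly_Mapping.keys k \<subseteq> {..<n}" "Poly_Mapping.keys l \<subseteq> {..<n}"
      using fg by (auto simp: mpolys_def)
    then show "?f k * ?g l * ?w (k + l) = (\<Sum>i<n.
        (?f k * ?w (k + unit_expo (n - 1 - i))) * (?g l * ?w (unit_expo i + l)))"
      by (subst weight_expand[OF n]) (simp_all add: sum_distrib_left mult.assoc mult.left_commute)
  qed
  also have "\<dots> = (\<Sum>i<n. \<Sum>k\<in>?F. \<Sum>l\<in>?G.
      (?f k * ?w (k + unit_expo (n - 1 - i))) * (?g l * ?w (unit_expo i + l)))"
    by (simp only: sum.swap[where A = ?G and B = "{..<n}"] sum.swap[where A = ?F and B = "{..<n}"])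
  also have "\<dots> = (\<Sum>i<n. linear_extension ?w (f * basis_mono (n - 1 - i)) *
      linear_extension ?w (basis_mono i * g))"
    by (simp add: sum_product basis_mono_def linear_extension_mult_single add.commute
        mult.commute[of "Poly_Mapping.single _ _" g])
  finally show "linear_extension ?w (f * g) = (\<Sum>i<n. linear_extension ?w (f * basis_mono (n - 1 - i)) *
      linear_extension ?w (basis_mono i * g))" .
qed (auto simp: linear_extension_add linear_extension_scale basis_mono_in_mpolys)

text \<open>On the line from \<open>t\<close> to \<open>t'\<close> every weight is constant or
  affine in \<open>s\<close>.\<close>

lemma dual_family_weight:
  assumes n: "n \<ge> 2"
  shows "dual_family n n (\<lambda>s. linear_extension (weight n (\<lambda>m. (1 - s) * t m + s * t' m)))
    basis_mono (\<lambda>i. basis_mono (n - 1 - i))"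
proof (rule dual_family.intro[OF dual_functional_weight[OF n]])
  fix f
  show "\<exists>p. \<forall>s. linear_extension (weight n (\<lambda>m. (1 - s) * t m + s * t' m)) f = poly p s"
    by (rule linear_extension_poly[of _ "\<lambda>m. if m \<in> quadrics n then 1
        else if m \<in> cubics n then [:t m, t' m - t m:] else 0"])
      (simp add: weight_def algebra_simps)
qed

section \<open>The dimension of the Gorenstein locus\<close>

text \<open>The chain comes from the images of a flag of coordinate subspaces \<open>T i\<close>, in
  which only the first \<open>i\<close> chosen cubics may have nonzero parameter.\<close>

lemma krull_dim_gorenstein_locus_ge:
  fixes p :: "nat \<Rightarrow> (nat \<Rightarrow>\<^sub>0 nat)"
  assumes n: "n \<ge> 2" and p: "inj_on p {..<K}" "p ` {..<K} \<subseteq> cubics n"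
  shows "ereal (real K) \<le> krull_dim (gorenstein_locus n n)"
proof -
  define \<phi> where "\<phi> t = apolar n (linear_extension (weight n t))" for t
  define T where "T i = {t :: (nat \<Rightarrow>\<^sub>0 nat) \<Rightarrow> complex. \<forall>m. t m \<noteq> 0 \<longrightarrow> m \<in> p ` {..<i}}" for i :: nat
  define B where "B = basis_mono ` {..<n}"
  note dual = dual_functional_weight[OF n]
  have B: "finite B" "B \<subseteq> mpolys n"
    using basis_mono_in_mpolys by (auto simp: B_def)
  have chart: "\<phi> t \<in> chart n n B" for t
    unfolding \<phi>_def B_def by (rule dual_functional.apolar_in_chart[OF dual])
  have basic: "openin (hilbert_scheme n n) {I \<in> chart n n B. g I \<noteq> 0}" if "g \<in> regular_functions n B" for g
    unfolding hilbert_scheme_def openin_topology_generated_by_iff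
    using B that by (intro generate_topology_on.Basis) blast
  have gor: "\<phi> t \<in> {I \<in> hilb_points n n. gorenstein n I}" for t
    using dual_functional.apolar_in_hilb_points[OF dual] dual_functional.gorenstein_apolar[OF dual]
    by (simp add: \<phi>_def)
  \<comment> \<open>The constant function 1 shows that the whole chart is open, hence contained in
    the space.\<close>
  have top: "\<phi> t \<in> topspace (gorenstein_locus n n)" for t
    using openin_subset[OF basic[OF regular_functions.const[of 1]]] chart gor
    by (auto simp: gorenstein_locus_def)
  \<comment> \<open>Both open sets pull back to nonempty, hence cofinite, subsets of the line, and
    these meet because the complex numbers are infinite.\<close>
  have line: "\<exists>s. \<phi> (\<lambda>m. (1 - s) * t m + s * t' m) \<in> U \<inter> V"
    if U: "openin (hilbert_scheme n n) U" "\<phi> t \<in> U" and V: "openin (hilbert_scheme n n) V" "\<phi> t' \<in> V"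
    for U V t t'
  proof -
    interpret dual_family n n "\<lambda>s. linear_extension (weight n (\<lambda>m. (1 - s) * t m + s * t' m))"
      basis_mono "\<lambda>i. basis_mono (n - 1 - i)"
      by (rule dual_family_weight[OF n])
    let ?P = "\<lambda>W. {s. \<phi> (\<lambda>m. (1 - s) * t m + s * t' m) \<in> W}"
    have "0 \<in> ?P U" "1 \<in> ?P V"
      using U V by simp_all
    then have "finite (- ?P U)" "finite (- ?P V)"
      using open_empty_or_cofinite[OF U(1)] open_empty_or_cofinite[OF V(1)] unfolding \<phi>_def by blast+
    then have "finite (- ?P U \<union> - ?P V)"
      by blast
    then have "- ?P U \<union> - ?P V \<noteq> UNIV"
      using infinite_UNIV_char_0 by metis
    then show ?thesis by blast
  qed
  show ?thesis
  proof (rule krull_dim_ge_chain)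
    fix i assume "i \<le> K"
    show "irreducible_in (gorenstein_locus n n) (\<phi> ` T i)"
      unfolding irreducible_in_def
    proof (intro conjI allI impI)
      show "\<phi> ` T i \<subseteq> topspace (gorenstein_locus n n)"
        using top by blast
      have "(\<lambda>m. 0) \<in> T i" by (simp add: T_def)
      then show "\<phi> ` T i \<noteq> {}" by blast
      fix U V assume U: "openin (gorenstein_locus n n) U" "U \<inter> \<phi> ` T i \<noteq> {}"
        and V: "openin (gorenstein_locus n n) V" "V \<inter> \<phi> ` T i \<noteq> {}"
      obtain U' where U': "openin (hilbert_scheme n n) U'" "U = U' \<inter> {I \<in> hilb_points n n. gorenstein n I}"
        using U(1) unfolding gorenstein_locus_def openin_subtopology by blast
      obtain V' where V': "openin (hilbert_scheme n n) V'" "V = V' \<inter> {I \<in> hilb_points n n. gorenstein n I}"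
        using V(1) unfolding gorenstein_locus_def openin_subtopology by blast
      obtain t where t: "t \<in> T i" "\<phi> t \<in> U'" using U(2) U'(2) by blast
      obtain t' where t': "t' \<in> T i" "\<phi> t' \<in> V'" using V(2) V'(2) by blast
      obtain s where s: "\<phi> (\<lambda>m. (1 - s) * t m + s * t' m) \<in> U' \<inter> V'"
        using line[OF U'(1) t(2) V'(1) t'(2)] by blast
      have "(\<lambda>m. (1 - s) * t m + s * t' m) \<in> T i"
        unfolding T_def
      proof (intro CollectI allI impI)
        fix m assume "(1 - s) * t m + s * t' m \<noteq> 0"
        then have "t m \<noteq> 0 \<or> t' m \<noteq> 0"
          by auto
        then show "m \<in> p ` {..<i}"
          using t(1) t'(1) unfolding T_def by blast
      qed
      then show "U \<inter> V \<inter> \<phi> ` T i \<noteq> {}"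
        using s gor unfolding U'(2) V'(2) by blast
    qed
  next
    fix i assume "i < K"
    show "\<phi> ` T i \<subseteq> \<phi> ` T (Suc i)"
      by (rule image_mono) (auto simp: T_def)
  next
    fix i assume i: "i < K"
    have pi: "p i \<in> cubics n"
      using p i by blast
    have "expo_degree n (p i) \<noteq> 0"
      using pi by (simp add: cubics_def)
    then obtain c where c: "c < n" "Poly_Mapping.lookup (p i) c \<noteq> 0"
      unfolding expo_degree_def by (metis lessThan_iff sum.neutral)
    then have c0: "c \<noteq> 0"
      using lookup_zero_cubics[OF pi] by metis
    define m where "m = p i - Poly_Mapping.single c 1"
    have m: "p i = m + unit_expo c"
      using c c0 by (intro poly_mapping_eqI)
        (auto simp: m_def unit_expo_def lookup_add lookup_minus lookup_single when_def)
    have "Poly_Mapping.keys m \<subseteq> Poly_Mapping.keys (p i)"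
      by (auto simp: m in_keys_iff lookup_add)
    then have f: "Poly_Mapping.single m 1 \<in> mpolys n"
      using pi by (auto simp: mpolys_def cubics_def)
    \<comment> \<open>The basis element \<open>x_{n-1-c}\<close> has dual \<open>x_c\<close>, so its
      coordinate in \<open>p i / x_c\<close> is the functional evaluated at \<open>p i\<close>,
      which is the parameter \<open>t (p i)\<close>.\<close>
    define g where "g I = coords I B (Poly_Mapping.single m 1) (basis_mono (n - 1 - c))" for I
    have g_reg: "g \<in> regular_functions n B"
      unfolding g_def using f c by (intro regular_functions.coord) (auto simp: B_def)
    have "p i \<notin> quadrics n"
      using expo_degree_quadrics[of "p i" n] pi by (auto simp: cubics_def)
    then have g: "g (\<phi> t) = t (p i)" for t
      using dual_functional.coords_basis[OF dual f, of "n - 1 - c"] c pi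
      by (simp add: g_def \<phi>_def B_def basis_mono_def mult_single linear_extension_single weight_def m[symmetric])
    show "\<exists>U. openin (gorenstein_locus n n) U \<and> U \<inter> \<phi> ` T i = {} \<and> U \<inter> \<phi> ` T (Suc i) \<noteq> {}"
    proof (intro exI conjI)
      let ?U = "{I \<in> chart n n B. g I \<noteq> 0} \<inter> {I \<in> hilb_points n n. gorenstein n I}"
      show "openin (gorenstein_locus n n) ?U"
        unfolding gorenstein_locus_def by (rule openin_subtopology_Int[OF basic[OF g_reg]])
      have "p i \<notin> p ` {..<i}"
        using inj_on_image_mem_iff[OF p(1), of i "{..<i}"] i by auto
      then have "t (p i) = 0" if "t \<in> T i" for t
        using that by (auto simp: T_def)
      then show "?U \<inter> \<phi> ` T i = {}"
        using g by auto
      \<comment> \<open>The indicator of the newly allowed cubic is a parameter on which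
        \<open>g\<close> takes the value 1.\<close>
      have "(\<lambda>m. if m = p i then 1 else 0) \<in> T (Suc i)"
        by (auto simp: T_def)
      moreover have "\<phi> (\<lambda>m. if m = p i then 1 else 0) \<in> ?U"
        using chart gor g by simp
      ultimately show "?U \<inter> \<phi> ` T (Suc i) \<noteq> {}"
        by blast
    qed
  qed
qed

text \<open>Take one variable from each of three disjoint index blocks of length \<open>r\<close>
  after 0. Disjointness lets the monomial determine the triple, and the largest index
  \<open>3 * r\<close> is low exactly because \<open>6 * r + 1 < n\<close>.\<close>

lemma many_cubics:
  assumes r: "6 * r + 1 < n"
  shows "\<exists>p. inj_on p {..<r ^ 3} \<and> p ` {..<r ^ 3} \<subseteq> cubics n"
proof -
  let ?S = "{..<r} \<times> {..<r} \<times> {..<r}"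
  define h :: "nat \<times> nat \<times> nat \<Rightarrow> (nat \<Rightarrow>\<^sub>0 nat)" where
    "h = (\<lambda>(a, b, c). Poly_Mapping.single (1 + a) 1 + Poly_Mapping.single (1 + r + b) 1
       + Poly_Mapping.single (1 + 2 * r + c) 1)"
  have look: "Poly_Mapping.lookup (h (a, b, c)) k = (if k = 1 + a then 1 else 0)
      + (if k = 1 + r + b then 1 else 0) + (if k = 1 + 2 * r + c then 1 else 0)" for a b c k
    by (simp add: h_def lookup_add lookup_single when_def)
  have inj: "a = a' \<and> b = b' \<and> c = c'"
    if lt: "a < r" "b < r" "c < r" "a' < r" "b' < r" "c' < r" and eq: "h (a, b, c) = h (a', b', c')"
    for a b c a' b' c'
  proof -
    have "Poly_Mapping.lookup (h (a', b', c')) (1 + a) \<noteq> 0"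
      "Poly_Mapping.lookup (h (a', b', c')) (1 + r + b) \<noteq> 0"
      "Poly_Mapping.lookup (h (a', b', c')) (1 + 2 * r + c) \<noteq> 0"
      unfolding eq[symmetric] look by simp_all
    then show ?thesis
      using lt unfolding look by (auto split: if_splits)
  qed
  have cubic: "h (a, b, c) \<in> cubics n" if lt: "a < r" "b < r" "c < r" for a b c
  proof -
    have "Poly_Mapping.keys (h (a, b, c)) \<subseteq> {k. 0 < k \<and> 2 * k + 1 < n}"
      using lt r by (auto simp: in_keys_iff look split: if_splits)
    moreover have "expo_degree n (h (a, b, c)) = 3"
      using lt r by (simp add: expo_degree_def look sum.distrib)
    ultimately show ?thesis
      by (simp add: cubics_def)
  qed
  have h_inj: "inj_on h ?S"
    by (rule inj_onI) (use inj in auto)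
  have h_cubic: "h ` ?S \<subseteq> cubics n"
    using cubic by auto
  obtain e where e: "bij_betw e {..<r ^ 3} ?S"
    using ex_bij_betw_nat_finite[of ?S]
    by (auto simp: card_cartesian_product power3_eq_cube lessThan_atLeast0 mult.assoc)
  have "inj_on (h \<circ> e) {..<r ^ 3}"
    using e h_inj by (simp add: bij_betw_def comp_inj_on)
  moreover have "(h \<circ> e) ` {..<r ^ 3} \<subseteq> cubics n"
    using e h_cubic unfolding image_comp[symmetric] by (simp add: bij_betw_def)
  ultimately show ?thesis by blast
qed

theorem proposition9p6:
  shows "\<exists>p :: real poly. degree p = 3 \<and> lead_coeff p > 0 \<and>
    (\<exists>N. \<forall>n\<ge>N.
       krull_dim (hilbert_scheme n n) \<ge> krull_dim (gorenstein_locus n n) \<and>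
       krull_dim (gorenstein_locus n n) \<ge> ereal (poly p (real n)))"
proof (intro exI conjI allI impI)
  \<comment> \<open>The largest \<open>r\<close> with \<open>6 * r + 1 < n\<close> satisfies
    \<open>r \<ge> (n - 7) / 6\<close>, and there are at least \<open>r ^ 3\<close> cubics.\<close>
  let ?p = "[:- 7 / 6, 1 / 6:] ^ 3 :: real poly"
  show "degree ?p = 3"
    by (simp add: degree_power_eq)
  show "lead_coeff ?p > 0"
    by (simp add: lead_coeff_power)
  \<comment> \<open>From 7 on, \<open>(n - 7) / 6\<close> is nonnegative, so cubing preserves the
    inequality.\<close>
  fix n :: nat assume n: "7 \<le> n"
  show "krull_dim (hilbert_scheme n n) \<ge> krull_dim (gorenstein_locus n n)"
    unfolding gorenstein_locus_def by (rule krull_dim_subtopology_le)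
  define r where "r = (n - 2) div 6"
  have r: "6 * r + 1 < n" "n \<le> 6 * r + 7"
    using n unfolding r_def by linarith+
  then obtain p where "inj_on p {..<r ^ 3}" "p ` {..<r ^ 3} \<subseteq> cubics n"
    using many_cubics by blast
  then have dim: "ereal (real (r ^ 3)) \<le> krull_dim (gorenstein_locus n n)"
    using n by (intro krull_dim_gorenstein_locus_ge) auto
  have "real n \<le> 6 * real r + 7"
    using r(2) by linarith
  then have "((real n - 7) / 6) ^ 3 \<le> real r ^ 3"
    using n by (intro power_mono) auto
  moreover have "poly ?p (real n) = ((real n - 7) / 6) ^ 3"
    by (simp only: poly_power) (simp add: field_simps)
  ultimately have "poly ?p (real n) \<le> real (r ^ 3)"
    by simp
  then show "krull_dim (gorenstein_locus n n) \<ge> ereal (poly ?p (real n))"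
    using dim by (meson ereal_less_eq(3) order_trans)
qed

end
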